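(* Let $F(x,y)=z\,\hat U(x,f)$, $f=c^2\hat Z(x,t)$, be a ${\cal UZ}$-Finsler metric function, let $H=H(x)$ with $0<H\le 1$, and write $U=\hat U(x,f)$, $Z=\hat Z(x,t)$. (i) The ${\cal UZ}$-Finsler space is a Finsleroid space with indicatrix curvature $H^2$, with azimuthal angle $\theta=\breve\theta(x,f)$, if and only if there are functions $T=T(x)$ and $C=C(x)$ of $x$ alone, related by $$T=\frac{C}{H^2},$$ such that the following two nonlinear differential equations are fulfilled: $$\Big(\frac{\partial\breve\theta}{\partial f}\Big)^2=H^2\,\frac{1}{U}\,\frac{\partial^2 \hat U}{\partial f^2},\qquad \frac1U\,\frac{\partial \hat U}{\partial f}\,f=T\sin^2\theta .$$ (ii) The condition of constancy of the indicatrix curvature of the ${\cal UZ}$-Finsler space does not impose any equation on the dependence of $Z=\hat Z(x,t)$ on $t$ (equivalently, of $Z=\breve Z(x,\phi)$ on $\phi$): if $\hat U$ and $\breve\theta$ satisfy the two equations of (i), then the space is a Finsleroid space for every choice of the dependence of $\hat Z$ on $t$ (subject only to the standing assumptions on ${\cal UZ}$-Finsler metric functions). To comply with the constancy of the indicatrix curvature, the function $\phi=\breve\phi(x,t)$ must obey $$\Big(\frac{\partial\breve\phi}{\partial t}\Big)^2=C\,\frac{Z_{tt}}{Z},\qquad Z_{tt}=\frac{\partial^2\hat Z}{\partial t^2},$$ that is, it must be given by the integral $\phi=\int\sqrt{C\,Z_{tt}/Z}\;dt$.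
   Context: Setting. ${\cal M}$ is a three-dimensional differentiable manifold carrying three vector fields, given through one-forms, linearly independent at each point $x$. At a point $x$, a tangent vector $y\in T_x{\cal M}$ is described by its three components $y^1,y^2,y^3$ with respect to the corresponding basis (the values of the three one-forms on $y$), and all tensor components below are taken with respect to $(y^1,y^2,y^3)$. Put $z=y^3$, $c^1=y^1/z$, $c^2=y^2/z$, $t=y^1/y^2=c^1/c^2$, on the region $z>0$, $y^2>0$, $c^2>0$. A Finsler metric function $F(x,y)$ (positively homogeneous of degree one in $y$, sufficiently smooth, with positive-definite metric tensor $g_{ij}=\frac12\,\partial^2F^2/\partial y^i\partial y^j$) is called a ${\cal UZ}$-Finsler metric function, and the space a ${\cal UZ}$-Finsler space, if it has the form $$F=z\,\hat U(x,f),\qquad f=c^2\,\hat Z(x,t),$$ with $f\neq0$ and sufficiently smooth functions $\hat U,\hat Z$. All considerations are local in $y$. The angles depend on the tangent vector in separated form: the azimuthal angle is $\theta=\breve\theta(x,f)$ and the polar angle is $\phi=\breve\phi(x,t)$, invertible respectively in $f$ and $t$, with $\sin\theta\ne0$ on the region; hence one can also write $U=\breve U(x,\theta)$, $f=\breve f(x,\theta)$, $Z=\breve Z(x,\phi)$, $t=\breve t(x,\phi)$. The ${\cal UZ}$-Finsler space is called a Finsleroid space with indicatrix curvature $H^2$ and azimuthal angle $\theta=\breve\theta(x,f)$ if its indicatrices $\{y\in T_x{\cal M}: F(x,y)=1\}$, with the Riemannian metric induced by $g_{ij}$, have constant positive curvature $H^2=H(x)^2$, realized by the angle representation: there exists a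 separated polar angle $\phi=\breve\phi(x,t)$ such that $$g_{ij}=l_il_j+\frac{1}{H^2}\big(\theta_i\theta_j+\sin^2\theta\,\phi_i\phi_j\big)F^2,$$ where $l_i=\partial F/\partial y^i$, $\theta_i=\partial\theta/\partial y^i$, $\phi_i=\partial\phi/\partial y^i$. In (ii), "complying with the constancy of the indicatrix curvature" means that this representation holds with the given $\theta$, $\phi$. *)

theory Defs
  imports "HOL-Analysis.Analysis"
begin

section \<open>Differentiability classes and partial derivatives\<close>

text \<open>Meant for open \<open>S\<close>. For functions of one real variable the only basis vector is \<open>1\<close>,
  so that the condition is the usual one on the iterated derivatives.\<close>

primrec Ck_on :: "nat \<Rightarrow> 'a::euclidean_space set \<Rightarrow> ('a \<Rightarrow> 'b::real_normed_vector) \<Rightarrow> bool" where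
  "Ck_on 0 S f \<longleftrightarrow> continuous_on S f"
| "Ck_on (Suc k) S f \<longleftrightarrow>
     f differentiable_on S \<and> (\<forall>b\<in>Basis. Ck_on k S (\<lambda>y. frechet_derivative f (at y) b))"

definition partial :: "'n::finite \<Rightarrow> (real^'n \<Rightarrow> 'b::real_normed_vector) \<Rightarrow> real^'n \<Rightarrow> 'b" where
  "partial i f y = frechet_derivative f (at y) (axis i 1)"


section \<open>Constant curvature\<close>

text \<open>Here \<open>h\<close> is a Riemannian metric in local coordinates \<open>u\<close>; \<open>christoffel h k i j\<close> is
  \<open>\<Gamma>\<^sup>k\<^sub>i\<^sub>j\<close>.\<close>

definition christoffel ::
    "(real^'n \<Rightarrow> real^'n^'n) \<Rightarrow> 'n::finite \<Rightarrow> 'n \<Rightarrow> 'n \<Rightarrow> real^'n \<Rightarrow> real" where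
  "christoffel h k i j u = 1 / 2 * (\<Sum>l\<in>UNIV. matrix_inv (h u) $ k $ l *
     (partial i (\<lambda>v. h v $ j $ l) u + partial j (\<lambda>v. h v $ i $ l) u
        - partial l (\<lambda>v. h v $ i $ j) u))"

text \<open>\<open>riemann h l k i j\<close> is the component \<open>R\<^sup>l\<^sub>k\<^sub>i\<^sub>j\<close> defined by
  \<open>R(\<partial>\<^sub>i, \<partial>\<^sub>j) \<partial>\<^sub>k = R\<^sup>l\<^sub>k\<^sub>i\<^sub>j \<partial>\<^sub>l\<close>, where
  \<open>R(X, Y) Z = \<nabla>\<^sub>X \<nabla>\<^sub>Y Z - \<nabla>\<^sub>Y \<nabla>\<^sub>X Z - \<nabla>\<^sub>[\<^sub>X\<^sub>,\<^sub>Y\<^sub>] Z\<close>.\<close>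

definition riemann ::
    "(real^'n \<Rightarrow> real^'n^'n) \<Rightarrow> 'n::finite \<Rightarrow> 'n \<Rightarrow> 'n \<Rightarrow> 'n \<Rightarrow> real^'n \<Rightarrow> real" where
  "riemann h l k i j u =
     partial i (christoffel h l j k) u - partial j (christoffel h l i k) u
     + (\<Sum>m\<in>UNIV. christoffel h l i m u * christoffel h m j k u
                 - christoffel h l j m u * christoffel h m i k u)"

definition constant_curvature_metric ::
    "(real^'n) set \<Rightarrow> (real^'n \<Rightarrow> real^'n^'n) \<Rightarrow> real \<Rightarrow> bool" where
  "constant_curvature_metric W h K \<longleftrightarrow> (\<forall>u\<in>W. \<forall>l k i j.
     riemann h l k i j u =
       K * ((if l = i then 1 else 0) * h u $ k $ j - (if l = j then 1 else 0) * h u $ k $ i))"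

definition surface_chart ::
    "(real^3) set \<Rightarrow> (real^2) set \<Rightarrow> (real^2 \<Rightarrow> real^3) \<Rightarrow> bool" where
  "surface_chart S W \<Phi> \<longleftrightarrow>
     open W \<and> Ck_on 3 W \<Phi> \<and> (\<forall>u\<in>W. inj (frechet_derivative \<Phi> (at u))) \<and>
     openin (top_of_set S) (\<Phi> ` W) \<and> (\<exists>\<Psi>. homeomorphism W (\<Phi> ` W) \<Phi> \<Psi>)"

definition induced_metric ::
    "(real^3 \<Rightarrow> real^3^3) \<Rightarrow> (real^2 \<Rightarrow> real^3) \<Rightarrow> real^2 \<Rightarrow> real^2^2" where
  "induced_metric g \<Phi> u = (\<chi> a b. partial a \<Phi> u \<bullet> (g (\<Phi> u) *v partial b \<Phi> u))"

text \<open>The curvature does not depend on the chart in which it is computed, so one chart around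
  each point suffices.\<close>

definition has_constant_curvature ::
    "(real^3) set \<Rightarrow> (real^3 \<Rightarrow> real^3^3) \<Rightarrow> real \<Rightarrow> bool" where
  "has_constant_curvature S g K \<longleftrightarrow> (\<forall>p\<in>S. \<exists>W \<Phi>.
     surface_chart S W \<Phi> \<and> p \<in> \<Phi> ` W \<and> constant_curvature_metric W (induced_metric g \<Phi>) K)"


section \<open>Finsler metric functions in one tangent space\<close>

text \<open>A tangent vector is given by its three components with respect to the frame of the
  manifold. The metric function lives on an open cone \<open>V\<close> of such vectors. Class \<open>C\<^sup>4\<close> is what
  the curvature of the indicatrix (two derivatives of the metric tensor) needs.\<close>

definition metric_tensor :: "(real^3 \<Rightarrow> real) \<Rightarrow> real^3 \<Rightarrow> real^3^3" where
  "metric_tensor F y = (\<chi> i j. 1 / 2 * partial i (partial j (\<lambda>v. (F v)\<^sup>2)) y)"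

definition finsler_metric_function :: "(real^3) set \<Rightarrow> (real^3 \<Rightarrow> real) \<Rightarrow> bool" where
  "finsler_metric_function V F \<longleftrightarrow>
     open V \<and> (\<forall>y\<in>V. \<forall>r>0. r *\<^sub>R y \<in> V) \<and>
     Ck_on 4 V F \<and> (\<forall>y\<in>V. F y > 0) \<and>
     (\<forall>y\<in>V. \<forall>r>0. F (r *\<^sub>R y) = r * F y) \<and>
     (\<forall>y\<in>V. \<forall>v. v \<noteq> 0 \<longrightarrow> v \<bullet> (metric_tensor F y *v v) > 0)"

definition indicatrix :: "(real^3) set \<Rightarrow> (real^3 \<Rightarrow> real) \<Rightarrow> (real^3) set" where
  "indicatrix V F = {y \<in> V. F y = 1}"


section \<open>UZ-Finsler metric functions\<close>

definition t_of :: "real^3 \<Rightarrow> real" where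
  "t_of y = y $ 1 / y $ 2"

definition f_of :: "(real \<Rightarrow> real) \<Rightarrow> real^3 \<Rightarrow> real" where
  "f_of Z y = (y $ 2 / y $ 3) * Z (t_of y)"

definition t_values :: "(real^3) set \<Rightarrow> real set" where
  "t_values V = t_of ` V"

definition f_values :: "(real^3) set \<Rightarrow> (real \<Rightarrow> real) \<Rightarrow> real set" where
  "f_values V Z = f_of Z ` V"

definition uz_finsler_function ::
    "(real^3) set \<Rightarrow> (real^3 \<Rightarrow> real) \<Rightarrow> (real \<Rightarrow> real) \<Rightarrow> (real \<Rightarrow> real) \<Rightarrow> bool" where
  "uz_finsler_function V F U Z \<longleftrightarrow>
     finsler_metric_function V F \<and>
     connected V \<and> V \<subseteq> {y. y $ 2 > 0 \<and> y $ 3 > 0} \<and>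
     Ck_on 4 (f_values V Z) U \<and> Ck_on 4 (t_values V) Z \<and>
     (\<forall>y\<in>V. f_of Z y \<noteq> 0 \<and> F y = y $ 3 * U (f_of Z y))"

definition azimuthal_angle ::
    "(real^3) set \<Rightarrow> (real \<Rightarrow> real) \<Rightarrow> (real \<Rightarrow> real) \<Rightarrow> bool" where
  "azimuthal_angle V Z \<theta> \<longleftrightarrow>
     Ck_on 3 (f_values V Z) \<theta> \<and> inj_on \<theta> (f_values V Z) \<and> (\<forall>f\<in>f_values V Z. sin (\<theta> f) \<noteq> 0)"

definition polar_angle :: "(real^3) set \<Rightarrow> (real \<Rightarrow> real) \<Rightarrow> bool" where
  "polar_angle V \<phi> \<longleftrightarrow> Ck_on 3 (t_values V) \<phi> \<and> inj_on \<phi> (t_values V)"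

text \<open>In the following definition \<open>\<theta>\<close> and \<open>\<phi>\<close> are regarded as functions of the tangent vector.\<close>

definition angle_representation ::
    "(real^3) set \<Rightarrow> (real^3 \<Rightarrow> real) \<Rightarrow> real \<Rightarrow> (real^3 \<Rightarrow> real) \<Rightarrow> (real^3 \<Rightarrow> real) \<Rightarrow> bool" where
  "angle_representation V F H \<theta> \<phi> \<longleftrightarrow> (\<forall>y\<in>V. \<forall>i j.
     metric_tensor F y $ i $ j = partial i F y * partial j F y
       + 1 / H\<^sup>2 * (partial i \<theta> y * partial j \<theta> y
                     + (sin (\<theta> y))\<^sup>2 * (partial i \<phi> y * partial j \<phi> y)) * (F y)\<^sup>2)"


section \<open>UZ-Finsler spaces and Finsleroid spaces\<close>

text \<open>The base point \<open>x\<close> ranges over \<open>M\<close>; the remaining arguments are families indexed by \<open>x\<close>.\<close>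

definition uz_finsler_space ::
    "'m set \<Rightarrow> ('m \<Rightarrow> (real^3) set) \<Rightarrow> ('m \<Rightarrow> real^3 \<Rightarrow> real) \<Rightarrow>
     ('m \<Rightarrow> real \<Rightarrow> real) \<Rightarrow> ('m \<Rightarrow> real \<Rightarrow> real) \<Rightarrow> bool" where
  "uz_finsler_space M V F U Z \<longleftrightarrow> (\<forall>x\<in>M. uz_finsler_function (V x) (F x) (U x) (Z x))"

definition finsleroid_space ::
    "'m set \<Rightarrow> ('m \<Rightarrow> (real^3) set) \<Rightarrow> ('m \<Rightarrow> real^3 \<Rightarrow> real) \<Rightarrow>
     ('m \<Rightarrow> real \<Rightarrow> real) \<Rightarrow> ('m \<Rightarrow> real) \<Rightarrow> ('m \<Rightarrow> real \<Rightarrow> real) \<Rightarrow> bool" where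
  "finsleroid_space M V F Z H \<theta> \<longleftrightarrow>
     (\<forall>x\<in>M. has_constant_curvature (indicatrix (V x) (F x)) (metric_tensor (F x)) ((H x)\<^sup>2)) \<and>
     (\<exists>\<phi>. \<forall>x\<in>M. polar_angle (V x) (\<phi> x) \<and>
        angle_representation (V x) (F x) (H x)
          (\<lambda>y. \<theta> x (f_of (Z x) y)) (\<lambda>y. \<phi> x (t_of y)))"

definition finsleroid_equations ::
    "'m set \<Rightarrow> ('m \<Rightarrow> real set) \<Rightarrow> ('m \<Rightarrow> real) \<Rightarrow> ('m \<Rightarrow> real \<Rightarrow> real) \<Rightarrow> ('m \<Rightarrow> real \<Rightarrow> real) \<Rightarrow>
     ('m \<Rightarrow> real) \<Rightarrow> ('m \<Rightarrow> real) \<Rightarrow> bool" where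
  "finsleroid_equations M J H U \<theta> T C \<longleftrightarrow> (\<forall>x\<in>M.
     T x = C x / (H x)\<^sup>2 \<and>
     (\<forall>f\<in>J x.
        (deriv (\<theta> x) f)\<^sup>2 = (H x)\<^sup>2 * (1 / U x f) * deriv (deriv (U x)) f \<and>
        1 / U x f * deriv (U x) f * f = T x * (sin (\<theta> x f))\<^sup>2))"

end

theory Submission
  imports Defs
begin

text \<open>
  Everything happens in one tangent space. Write \<open>f\<^sub>i\<close> and \<open>t\<^sub>i\<close> for the gradients of \<open>f\<close> and \<open>t\<close>.
  Since \<open>z f = y\<^sup>2 Z(t)\<close> is homogeneous of degree one in \<open>(y\<^sup>1, y\<^sup>2)\<close>, two differentiations of
  \<open>F = z U(f)\<close> give
    \<open>g\<^sub>i\<^sub>j = F\<^sub>i F\<^sub>j + F (z U'' f\<^sub>i f\<^sub>j + y\<^sup>2 U' Z'' t\<^sub>i t\<^sub>j)\<close>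
  (\<open>metric_tensor_eq\<close>). The angle representation has the same shape, with coefficients
  \<open>F\<^sup>2 \<theta>'\<^sup>2 / H\<^sup>2\<close> and \<open>F\<^sup>2 sin\<^sup>2 \<theta> \<phi>'\<^sup>2 / H\<^sup>2\<close>. As \<open>f\<^sub>i\<close> and \<open>t\<^sub>i\<close> are independent, it amounts to the two
  scalar equations \<open>\<theta>'\<^sup>2 = H\<^sup>2 U'' / U\<close> and \<open>\<phi>'\<^sup>2 sin\<^sup>2 \<theta> = H\<^sup>2 (f U' / U) (Z'' / Z)\<close>
  (\<open>angle_representation_iff\<close>).

  The second equation separates: \<open>f U' / (U sin\<^sup>2 \<theta>)\<close> depends on \<open>f\<close> only and equals a function of \<open>t\<close>
  only, so on a connected domain it is a constant \<open>T\<close> (\<open>separation_of_variables\<close>), and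
  \<open>\<phi>'\<^sup>2 = C Z'' / Z\<close> with \<open>C = T H\<^sup>2\<close> is what is left.

  Conversely, positive definiteness of \<open>g\<close> forces \<open>U'' > 0\<close> and \<open>(f U' / U) (Z'' / Z) > 0\<close>. Hence, once
  the two equations in \<open>f\<close> hold, \<open>C Z'' / Z\<close> is positive whatever \<open>Z\<close> is, and a polar angle is obtained
  as an antiderivative of its square root (\<open>exists_polar_angle\<close>). Finally \<open>(\<theta>, \<phi>)\<close> is a global
  coordinate system on the indicatrix, because a vector with \<open>F = 1\<close> is recovered from \<open>f\<close> and \<open>t\<close> by
  \<open>z = 1 / U(f)\<close>. In these coordinates the angle representation says that the induced metric is
  \<open>(d\<theta>\<^sup>2 + sin\<^sup>2 \<theta> d\<phi>\<^sup>2) / H\<^sup>2\<close>, the round metric of curvature \<open>H\<^sup>2\<close>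
  (\<open>has_constant_curvature_of_angle_representation\<close>).
\<close>

section \<open>Functions of class \<open>C\<^sup>k\<close>\<close>

lemma frechet_derivative_cong_open:
  assumes "open S" "x \<in> S" "\<And>y. y \<in> S \<Longrightarrow> f y = g y"
  shows "frechet_derivative f (at x) = frechet_derivative g (at x)"
proof -
  have "(f has_derivative D) (at x) \<longleftrightarrow> (g has_derivative D) (at x)" for D
    using has_derivative_transform_within_open[OF _ assms(1,2)] assms(3) by metis
  then show ?thesis unfolding frechet_derivative_def by simp
qed

lemma Ck_on_cong:
  assumes "open S" "\<And>y. y \<in> S \<Longrightarrow> f y = g y"
  shows "Ck_on k S f \<longleftrightarrow> Ck_on k S g"
  using assms(2)
proof (induction k arbitrary: f g)
  case 0
  then show ?case by (simp cong: continuous_on_cong)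
next
  case (Suc k)
  have "f differentiable_on S \<longleftrightarrow> g differentiable_on S"
    unfolding differentiable_on_def
    by (metis Suc.prems differentiable_transform_within zero_less_one)
  moreover have "Ck_on k S (\<lambda>y. frechet_derivative f (at y) b) \<longleftrightarrow>
      Ck_on k S (\<lambda>y. frechet_derivative g (at y) b)" for b
    by (rule Suc.IH, subst frechet_derivative_cong_open[OF assms(1) _ Suc.prems]) auto
  ultimately show ?case by simp
qed

lemma Ck_on_subset: "Ck_on k S f \<Longrightarrow> T \<subseteq> S \<Longrightarrow> Ck_on k T f"
  by (induction k arbitrary: f) (auto intro: continuous_on_subset differentiable_on_subset)

lemma Ck_on_imp_continuous_on: "Ck_on k S f \<Longrightarrow> continuous_on S f"
  by (cases k) (auto intro: differentiable_imp_continuous_on)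

lemma Ck_on_SucI:
  assumes "open S" "\<And>x. x \<in> S \<Longrightarrow> (f has_derivative f' x) (at x)"
    and "\<And>b. b \<in> Basis \<Longrightarrow> Ck_on k S (\<lambda>x. f' x b)"
  shows "Ck_on (Suc k) S f"
proof -
  have "frechet_derivative f (at x) = f' x" if "x \<in> S" for x
    using frechet_derivative_at[OF assms(2)[OF that]] by simp
  then have "Ck_on k S (\<lambda>x. frechet_derivative f (at x) b)" if "b \<in> Basis" for b
    using assms(3)[OF that] Ck_on_cong[OF assms(1), of "\<lambda>x. frechet_derivative f (at x) b"] by simp
  moreover have "f differentiable_on S"
    using assms(2) differentiable_at_withinI
    by (force simp: differentiable_on_def differentiable_def)
  ultimately show ?thesis by simp
qed

lemma Ck_on_SucD:
  assumes "open S" "Ck_on (Suc k) S f"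
  shows "\<And>x. x \<in> S \<Longrightarrow> (f has_derivative frechet_derivative f (at x)) (at x)"
    and "\<And>b. b \<in> Basis \<Longrightarrow> Ck_on k S (\<lambda>x. frechet_derivative f (at x) b)"
  using assms by (auto simp: differentiable_on_eq_differentiable_at frechet_derivative_works)

lemma Ck_on_Suc_imp: "open S \<Longrightarrow> Ck_on (Suc k) S f \<Longrightarrow> Ck_on k S f"
proof (induction k arbitrary: f)
  case 0
  then show ?case by (auto intro: differentiable_imp_continuous_on)
next
  case (Suc k)
  show ?case
    by (rule Ck_on_SucI[OF Suc.prems(1) Ck_on_SucD(1)[OF Suc.prems]])
      (auto intro: Suc.IH[OF Suc.prems(1) Ck_on_SucD(2)[OF Suc.prems]])
qed

lemma Ck_on_antimono: "k \<le> n \<Longrightarrow> open S \<Longrightarrow> Ck_on n S f \<Longrightarrow> Ck_on k S f"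
  by (induction rule: inc_induct) (auto intro: Ck_on_Suc_imp simp del: Ck_on.simps)

lemma Ck_on_const: "open S \<Longrightarrow> Ck_on k S (\<lambda>_. c)"
proof (induction k arbitrary: c)
  case (Suc k)
  show ?case by (rule Ck_on_SucI[OF Suc.prems]) (auto intro: Suc derivative_intros)
qed simp

lemma Ck_on_bounded_linear: "open S \<Longrightarrow> bounded_linear f \<Longrightarrow> Ck_on k S f"
  by (cases k)
    (auto intro!: Ck_on_SucI Ck_on_const linear_continuous_on bounded_linear_imp_has_derivative
      simp del: Ck_on.simps(2))

lemma Ck_on_add:
  "open S \<Longrightarrow> Ck_on k S f \<Longrightarrow> Ck_on k S g \<Longrightarrow> Ck_on k S (\<lambda>x. f x + g x)"
proof (induction k arbitrary: f g)
  case (Suc k)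
  note f = Ck_on_SucD[OF Suc.prems(1,2)] and g = Ck_on_SucD[OF Suc.prems(1,3)]
  show ?case
    by (rule Ck_on_SucI[OF Suc.prems(1) has_derivative_add[OF f(1) g(1)]])
      (auto intro: Suc.IH Suc.prems(1) f(2) g(2))
qed (auto intro: continuous_intros)

lemma Ck_on_scaleR:
  fixes f :: "'a::euclidean_space \<Rightarrow> real"
  shows "open S \<Longrightarrow> Ck_on k S f \<Longrightarrow> Ck_on k S g \<Longrightarrow> Ck_on k S (\<lambda>x. f x *\<^sub>R g x)"
proof (induction k arbitrary: f g)
  case (Suc k)
  note f = Ck_on_SucD[OF Suc.prems(1,2)] and g = Ck_on_SucD[OF Suc.prems(1,3)]
  show ?case
    by (rule Ck_on_SucI[OF Suc.prems(1) has_derivative_scaleR[OF f(1) g(1)]])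
      (auto intro!: Ck_on_add Suc.IH Suc.prems(1) f(2) g(2)
        intro: Ck_on_Suc_imp[OF Suc.prems(1)] Suc.prems(2,3) simp del: Ck_on.simps)
qed (auto intro: continuous_intros)

lemma Ck_on_mult:
  fixes f g :: "'a::euclidean_space \<Rightarrow> real"
  shows "open S \<Longrightarrow> Ck_on k S f \<Longrightarrow> Ck_on k S g \<Longrightarrow> Ck_on k S (\<lambda>x. f x * g x)"
  using Ck_on_scaleR[of S k f g] by simp

lemma Ck_on_real_SucD:
  fixes f :: "real \<Rightarrow> real"
  assumes "open S" "Ck_on (Suc k) S f"
  shows "\<And>x. x \<in> S \<Longrightarrow> (f has_real_derivative deriv f x) (at x)" "Ck_on k S (deriv f)"
proof -
  show D: "(f has_real_derivative deriv f x) (at x)" if "x \<in> S" for x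
    using Ck_on_SucD(1)[OF assms that]
    by (metis DERIV_deriv_iff_real_differentiable differentiable_def)
  have "frechet_derivative f (at x) 1 = deriv f x" if "x \<in> S" for x
    using frechet_derivative_at[OF D[OF that, unfolded has_field_derivative_def], symmetric] by simp
  then show "Ck_on k S (deriv f)"
    using Ck_on_SucD(2)[OF assms, of 1]
      Ck_on_cong[OF assms(1), of "\<lambda>x. frechet_derivative f (at x) 1" "deriv f"] by simp
qed

lemma Ck_on_real_SucI:
  fixes f :: "real \<Rightarrow> real"
  assumes "open S" "\<And>x. x \<in> S \<Longrightarrow> (f has_real_derivative f' x) (at x)" "Ck_on k S f'"
  shows "Ck_on (Suc k) S f"
  using assms
  by (intro Ck_on_SucI[OF assms(1), of f "\<lambda>x h. f' x * h"]) (auto simp: has_field_derivative_def)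

text \<open>With a scalar outer function the derivative of the composite is a product of two scalars, which
  keeps the induction on \<open>k\<close> inside the algebra of \<open>C\<^sup>k\<close> functions. This case suffices for a chart whose
  components are built from functions of one variable.\<close>

lemma Ck_on_compose:
  fixes f :: "real \<Rightarrow> real" and g :: "'a::euclidean_space \<Rightarrow> real"
  assumes "open S" "open T"
  shows "Ck_on k T f \<Longrightarrow> Ck_on k S g \<Longrightarrow> g ` S \<subseteq> T \<Longrightarrow> Ck_on k S (\<lambda>x. f (g x))"
proof (induction k arbitrary: f)
  case 0
  then show ?case by (auto intro: continuous_on_compose2)
next
  case (Suc k)
  note g = Ck_on_SucD[OF assms(1) Suc.prems(2)]
  note f = Ck_on_real_SucD[OF assms(2) Suc.prems(1)]
  have "Ck_on k S (\<lambda>x. deriv f (g x))"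
    by (rule Suc.IH[OF f(2) Ck_on_Suc_imp[OF assms(1) Suc.prems(2)] Suc.prems(3)])
  then have K: "Ck_on k S (\<lambda>x. deriv f (g x) * frechet_derivative g (at x) b)" if "b \<in> Basis" for b
    using g(2)[OF that] by (intro Ck_on_mult assms(1))
  have D: "((\<lambda>x. f (g x)) has_derivative
      (\<lambda>h. deriv f (g x) * frechet_derivative g (at x) h)) (at x)" if "x \<in> S" for x
    using has_derivative_compose[OF g(1)[OF that], of f] f(1)[of "g x"] Suc.prems(3) that
    by (auto simp: has_field_derivative_def)
  show ?case by (rule Ck_on_SucI[OF assms(1) D K])
qed

lemma Ck_on_inverse: "Ck_on k (- {0}) (inverse :: real \<Rightarrow> real)"
proof (induction k)
  case 0
  show ?case by (auto intro: continuous_intros)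
next
  case (Suc k)
  have K: "Ck_on k (- {0}) (\<lambda>x. (- 1) * (inverse x * inverse x) :: real)"
    by (intro Ck_on_mult Ck_on_const Suc) auto
  have D: "(inverse has_real_derivative (- 1) * (inverse x * inverse x)) (at x)"
    if "x \<in> - {0}" for x :: real
    using DERIV_inverse[of x] that by (simp add: power2_eq_square)
  show ?case by (rule Ck_on_real_SucI[OF _ D K]) auto
qed

lemma Ck_on_divide:
  fixes f g :: "'a::euclidean_space \<Rightarrow> real"
  assumes "open S" "Ck_on k S f" "Ck_on k S g" "\<And>x. x \<in> S \<Longrightarrow> g x \<noteq> 0"
  shows "Ck_on k S (\<lambda>x. f x / g x)"
  unfolding divide_inverse
  by (intro Ck_on_mult assms Ck_on_compose[OF _ _ Ck_on_inverse]) (use assms in auto)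

lemma Ck_on_sqrt: "Ck_on k {0<..} sqrt"
proof (induction k)
  case 0
  show ?case by (auto intro: continuous_intros)
next
  case (Suc k)
  have K: "Ck_on k {0<..} (\<lambda>x. inverse (sqrt x) / 2)"
    unfolding divide_inverse
    by (intro Ck_on_mult Ck_on_const Ck_on_compose[OF _ _ Ck_on_inverse Suc]) auto
  show ?case
    by (rule Ck_on_real_SucI[OF _ _ K]) (auto intro!: DERIV_real_sqrt)
qed

text \<open>The derivative of the inverse is the reciprocal of the derivative at the inverse, so each order of
  differentiability of the inverse gives the next one.\<close>

lemma Ck_on_the_inv_into:
  fixes f :: "real \<Rightarrow> real"
  assumes "open S" "Ck_on (Suc k) S f" "inj_on f S" "\<And>x. x \<in> S \<Longrightarrow> deriv f x \<noteq> 0"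
  shows "open (f ` S)" "Ck_on (Suc k) (f ` S) (the_inv_into S f)"
proof -
  let ?g = "the_inv_into S f"
  note f = Ck_on_real_SucD[OF assms(1,2)]
  have cont: "continuous_on S f"
    using Ck_on_imp_continuous_on[OF assms(2)] .
  show op: "open (f ` S)"
    using invariance_of_domain[OF cont assms(1,3)] .
  have g: "?g (f x) = x" if "x \<in> S" for x
    using the_inv_into_f_f[OF assms(3) that] .
  have dg: "(?g has_real_derivative inverse (deriv f (?g y))) (at y)" if y: "y \<in> f ` S" for y
  proof -
    obtain x where x: "x \<in> S" "y = f x" using y by blast
    have "(?g has_field_derivative inverse (deriv f x)) (at (f x))"
      unfolding has_field_derivative_def
      using x assms(4) f(1)[OF x(1)] g cont
      by (intro has_derivative_inverse_strong[OF assms(1) x(1), of f ?g])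
        (auto simp: has_field_derivative_def fun_eq_iff)
    then show ?thesis using x g by simp
  qed
  have gS: "?g ` f ` S \<subseteq> S" using g by auto
  have "Ck_on j (f ` S) ?g" if "j \<le> Suc k" for j
    using that
  proof (induction j)
    case 0
    show ?case
      using DERIV_continuous_on[OF has_field_derivative_at_within[OF dg]] by simp
  next
    case (Suc j)
    have "Ck_on j (f ` S) (\<lambda>y. deriv f (?g y))"
    proof (rule Ck_on_compose[OF op assms(1) _ _ gS])
      show "Ck_on j S (deriv f)" using Ck_on_antimono[OF _ assms(1) f(2), of j] Suc.prems by simp
      show "Ck_on j (f ` S) ?g" using Suc by simp
    qed
    moreover have "(\<lambda>y. deriv f (?g y)) ` f ` S \<subseteq> - {0}"
      using gS assms(4) by (auto simp: g)
    ultimately have "Ck_on j (f ` S) (\<lambda>y. inverse (deriv f (?g y)))"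
      by (intro Ck_on_compose[OF op _ Ck_on_inverse]) auto
    with dg show ?case by (rule Ck_on_real_SucI[OF op])
  qed
  then show "Ck_on (Suc k) (f ` S) ?g" by blast
qed

text \<open>Existence on an open, possibly unbounded interval, where no common closed interval of integration
  is available: locally the interval is enlarged to contain both the base point and the point in
  question.\<close>

lemma antiderivative_on_open_interval:
  fixes g :: "real \<Rightarrow> real"
  assumes "open J" "connected J" "continuous_on J g"
  obtains G where "\<And>x. x \<in> J \<Longrightarrow> (G has_real_derivative g x) (at x)"
proof (cases "J = {}")
  case False
  then obtain c where c: "c \<in> J" by blast
  have J: "{a..b} \<subseteq> J" if "a \<in> J" "b \<in> J" for a b
    using assms(2) that by (meson atLeastAtMost_iff connected_iff_interval subsetI)
  have "((\<lambda>u. LBINT y=c..u. g y) has_real_derivative g x) (at x)" if "x \<in> J" for x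
  proof -
    obtain e1 where e1: "e1 > 0" "cball x e1 \<subseteq> J" using assms(1) \<open>x \<in> J\<close> open_contains_cball by blast
    define a b where "a = min c (x - e1)" and "b = max c (x + e1)"
    have ab: "a \<in> J" "b \<in> J" using e1 c by (auto simp: a_def b_def min_def max_def subset_iff dist_real_def)
    have "((\<lambda>u. LBINT y=c..u. g y) has_vector_derivative g x) (at x within {a..b})"
      using continuous_on_subset[OF assms(3) J[OF ab]] e1(1)
      by (intro interval_integral_FTC2) (auto simp: a_def b_def)
    moreover have "at x within {a..b} = at x"
      using e1(1) by (intro at_within_interior) (auto simp: a_def b_def)
    ultimately show ?thesis
      unfolding has_real_derivative_iff_has_vector_derivative by simp
  qed
  then show thesis by (rule that)
qed auto

text \<open>A continuous derivative without zeros has a fixed sign \<open>s\<close> on an interval; this is the sign left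
  open when a derivative is only known through its square.\<close>

lemma abs_deriv_has_integral:
  fixes \<phi> :: "real \<Rightarrow> real"
  assumes J: "connected J" and cont: "continuous_on J (deriv \<phi>)"
    and \<phi>: "\<And>t. t \<in> J \<Longrightarrow> (\<phi> has_real_derivative deriv \<phi> t) (at t)"
    and nz: "\<And>t. t \<in> J \<Longrightarrow> deriv \<phi> t \<noteq> 0"
  shows "\<exists>s\<in>{1, -1}. \<forall>a\<in>J. \<forall>b\<in>J. a \<le> b \<longrightarrow>
    ((\<lambda>t. \<bar>deriv \<phi> t\<bar>) has_integral s * (\<phi> b - \<phi> a)) {a..b}"
proof -
  have "connected (deriv \<phi> ` J)" using connected_continuous_image[OF cont J] .
  moreover have "0 \<notin> deriv \<phi> ` J" using nz by auto
  ultimately have same: "\<not> (deriv \<phi> a < 0 \<and> deriv \<phi> b > 0)" if "a \<in> J" "b \<in> J" for a b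
    using that connectedD_interval[of "deriv \<phi> ` J" "deriv \<phi> a" "deriv \<phi> b" 0] by auto
  have "(\<forall>t\<in>J. deriv \<phi> t > 0) \<or> (\<forall>t\<in>J. deriv \<phi> t < 0)"
    using nz same by (meson linorder_neqE)
  then obtain s :: real where s: "s \<in> {1, -1}" "\<And>t. t \<in> J \<Longrightarrow> \<bar>deriv \<phi> t\<bar> = s * deriv \<phi> t"
  proof (elim disjE, goal_cases)
    case 1
    then show ?case by (intro 1(1)[of 1]) auto
  next
    case 2
    then show ?case by (intro 2(1)[of "-1"]) auto
  qed
  have "((\<lambda>t. \<bar>deriv \<phi> t\<bar>) has_integral s * (\<phi> b - \<phi> a)) {a..b}"
    if ab: "a \<in> J" "b \<in> J" "a \<le> b" for a b
  proof -
    have sub: "{a..b} \<subseteq> J" using J ab unfolding connected_iff_interval by (meson atLeastAtMost_iff subsetI)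
    have "(\<phi> has_vector_derivative deriv \<phi> t) (at t within {a..b})" if "t \<in> {a..b}" for t
      using has_field_derivative_at_within[OF \<phi>[of t]] sub that
      unfolding has_real_derivative_iff_has_vector_derivative by blast
    then have "(deriv \<phi> has_integral \<phi> b - \<phi> a) {a..b}"
      using ab(3) by (intro fundamental_theorem_of_calculus)
    then have "((\<lambda>t. s * deriv \<phi> t) has_integral s * (\<phi> b - \<phi> a)) {a..b}"
      by (rule has_integral_mult_right)
    then show ?thesis
      by (rule has_integral_eq[rotated]) (use s(2) sub in auto)
  qed
  then show ?thesis using s(1) by blast
qed

section \<open>The round metric on the sphere\<close>

lemma partial_cong_open:
  assumes "open S" "u \<in> S" "\<And>v. v \<in> S \<Longrightarrow> f v = g v"
  shows "partial i f u = partial i g u"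
  using frechet_derivative_cong_open[OF assms] by (simp add: partial_def)

lemma partial_of_coordinate_1:
  fixes p :: "real \<Rightarrow> real" and u :: "real^2"
  assumes "(p has_real_derivative p') (at (u $ 1))"
  shows "partial i (\<lambda>v. p (v $ 1)) u = (if i = 1 then p' else 0)"
proof -
  have "((\<lambda>v. v $ 1) has_derivative (\<lambda>v. v $ 1)) (at u)"
    by (intro bounded_linear_imp_has_derivative bounded_linear_vec_nth)
  from has_derivative_compose[OF this assms[unfolded has_field_derivative_def]]
  show ?thesis
    by (auto simp: partial_def axis_def dest!: frechet_derivative_at[symmetric])
qed

text \<open>The metric \<open>(d\<theta>\<^sup>2 + sin\<^sup>2 \<theta> d\<phi>\<^sup>2) / H\<^sup>2\<close> of the sphere of radius \<open>1 / H\<close>, which depends only on the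
  first coordinate \<open>s = \<theta>\<close>.\<close>

definition round_metric :: "real \<Rightarrow> real \<Rightarrow> real^2^2" where
  "round_metric H s = (\<chi> a b. if a = b then (if a = 1 then 1 else (sin s)\<^sup>2) / H\<^sup>2 else 0)"

lemma matrix_inv_round_metric:
  assumes "H \<noteq> 0" "sin s \<noteq> 0"
  shows "matrix_inv (round_metric H s) =
    (\<chi> a b. if a = b then H\<^sup>2 / (if a = 1 then 1 else (sin s)\<^sup>2) else 0)" (is "_ = ?B")
proof -
  let ?A = "round_metric H s"
  have AB: "?A ** ?B = mat 1"
    using assms by (simp add: vec_eq_iff forall_2 round_metric_def matrix_matrix_mult_def sum_2 mat_def)
  have BA: "?B ** ?A = mat 1"
    using assms by (simp add: vec_eq_iff forall_2 round_metric_def matrix_matrix_mult_def sum_2 mat_def)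
  have "?A ** matrix_inv ?A = mat 1 \<and> matrix_inv ?A ** ?A = mat 1"
    unfolding matrix_inv_def by (rule someI[where x = ?B]) (simp add: AB BA)
  then have "matrix_inv ?A ** (?A ** ?B) = ?B"
    by (simp add: matrix_mul_assoc)
  then show ?thesis by (simp add: AB)
qed

text \<open>The Christoffel symbols \<open>\<Gamma>\<^sup>k\<^sub>i\<^sub>j\<close> of the round metric, in which the radius cancels.\<close>

definition round_christoffel :: "2 \<Rightarrow> 2 \<Rightarrow> 2 \<Rightarrow> real \<Rightarrow> real" where
  "round_christoffel k i j s =
    (if k = 1 then (if i = 2 \<and> j = 2 then - (sin s * cos s) else 0)
     else if i = j then 0 else cos s / sin s)"

text \<open>Since all functions involved depend on the first coordinate alone, the curvature tensor is computed
  from ordinary derivatives.\<close>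

lemma constant_curvature_round_metric:
  assumes W: "open W" and H: "H \<noteq> 0" and s: "\<And>u. u \<in> W \<Longrightarrow> sin (u $ 1) \<noteq> 0"
    and h: "\<And>u. u \<in> W \<Longrightarrow> h u = round_metric H (u $ 1)"
  shows "constant_curvature_metric W h (H\<^sup>2)"
proof -
  have dh: "partial i (\<lambda>v. h v $ j $ l) u =
      (if i = 1 \<and> j = 2 \<and> l = 2 then 2 * sin (u $ 1) * cos (u $ 1) / H\<^sup>2 else 0)"
    if "u \<in> W" for u i j l
  proof -
    have "partial i (\<lambda>v. h v $ j $ l) u = partial i (\<lambda>v. round_metric H (v $ 1) $ j $ l) u"
      by (rule partial_cong_open[OF W that]) (simp add: h)
    also have "((\<lambda>s. round_metric H s $ j $ l) has_real_derivative
        (if j = 2 \<and> l = 2 then 2 * sin (u $ 1) * cos (u $ 1) / H\<^sup>2 else 0)) (at (u $ 1))"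
      using exhaust_2[of j] exhaust_2[of l] H
      by (auto simp: round_metric_def power2_eq_square power4_eq_xxxx field_simps
          intro!: derivative_eq_intros)
    from partial_of_coordinate_1[OF this]
    have "partial i (\<lambda>v. round_metric H (v $ 1) $ j $ l) u =
      (if i = 1 \<and> j = 2 \<and> l = 2 then 2 * sin (u $ 1) * cos (u $ 1) / H\<^sup>2 else 0)"
      by simp
    finally show ?thesis .
  qed
  have Gam: "christoffel h k i j u = round_christoffel k i j (u $ 1)" if "u \<in> W" for u k i j
    using exhaust_2[of k] exhaust_2[of i] exhaust_2[of j] H s[OF that]
    by (auto simp: christoffel_def round_christoffel_def dh[OF that] h[OF that]
        matrix_inv_round_metric sum_2 power2_eq_square field_simps)
  have dGam: "partial m (christoffel h k i j) u =
      (if m = 1 then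
        (if k = 1 then (if i = 2 \<and> j = 2 then (sin (u $ 1))\<^sup>2 - (cos (u $ 1))\<^sup>2 else 0)
         else if i = j then 0 else - 1 / (sin (u $ 1))\<^sup>2) else 0)" (is "_ = (if _ then ?D else 0)")
    if "u \<in> W" for u m k i j
  proof -
    have "partial m (christoffel h k i j) u = partial m (\<lambda>v. round_christoffel k i j (v $ 1)) u"
      by (rule partial_cong_open[OF W that]) (simp add: Gam)
    also have "(round_christoffel k i j has_real_derivative ?D) (at (u $ 1))"
    proof -
      have "((\<lambda>s. - (sin s * cos s)) has_real_derivative
          (sin (u $ 1))\<^sup>2 - (cos (u $ 1))\<^sup>2) (at (u $ 1))"
        by (auto intro!: derivative_eq_intros simp: power2_eq_square)
      moreover have "((\<lambda>s. cos s / sin s) has_real_derivative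
          (- sin (u $ 1) * sin (u $ 1) - cos (u $ 1) * cos (u $ 1)) / (sin (u $ 1) * sin (u $ 1)))
          (at (u $ 1))"
        using s[OF that] by (intro DERIV_divide DERIV_cos DERIV_sin)
      moreover have "- sin (u $ 1) * sin (u $ 1) - cos (u $ 1) * cos (u $ 1) = - 1"
        using sin_cos_squared_add3[of "u $ 1"] by linarith
      ultimately show ?thesis
        by (simp add: round_christoffel_def[abs_def] power2_eq_square)
    qed
    from partial_of_coordinate_1[OF this]
    have "partial m (\<lambda>v. round_christoffel k i j (v $ 1)) u = (if m = 1 then ?D else 0)" .
    finally show ?thesis .
  qed
  have "riemann h l k i j u =
      H\<^sup>2 * ((if l = i then 1 else 0) * h u $ k $ j - (if l = j then 1 else 0) * h u $ k $ i)"
    if u: "u \<in> W" for u l k i j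
  proof -
    have [simp]: "sin (u $ 1) \<noteq> 0" "H \<noteq> 0" using s[OF u] H by auto
    have cot: "cos (u $ 1) * cos (u $ 1) / (sin (u $ 1) * sin (u $ 1)) =
        1 / (sin (u $ 1) * sin (u $ 1)) - 1"
      using sin_cos_squared_add3[of "u $ 1"] by (simp add: field_simps)
    show ?thesis
      using exhaust_2[of k] exhaust_2[of i] exhaust_2[of j] exhaust_2[of l]
      by (elim disjE; hypsubst)
        (simp_all add: riemann_def dGam[OF u] Gam[OF u] h[OF u] round_metric_def
          round_christoffel_def sum_2, simp_all add: cot power2_eq_square)
  qed
  then show ?thesis unfolding constant_curvature_metric_def by blast
qed

section \<open>The metric tensor of a UZ-Finsler metric function\<close>

lemma has_derivative_coordinate: "((\<lambda>v. v $ k) has_derivative (\<lambda>h. h $ k)) (at (y::real^'n))"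
  by (intro bounded_linear_imp_has_derivative bounded_linear_vec_nth)

lemma partial_eq_nth:
  fixes \<psi> :: "real^'n \<Rightarrow> real"
  assumes "(\<psi> has_derivative (\<lambda>h. g \<bullet> h)) (at y)"
  shows "partial i \<psi> y = g $ i"
  using frechet_derivative_at[OF assms, symmetric] by (simp add: partial_def inner_axis)

text \<open>Both the Finsler metric tensor and its angle representation are weighted sums of three
  squares of linear forms; this lemma evaluates them on vectors.\<close>

lemma quadratic_form_of_sum_of_squares:
  fixes g :: "real^'n^'n"
  assumes "\<And>i j. g $ i $ j = a $ i * a $ j + (p * b $ i * b $ j + q * c $ i * c $ j)"
  shows "v \<bullet> (g *v w) = (a \<bullet> v) * (a \<bullet> w) + (p * (b \<bullet> v) * (b \<bullet> w) + q * (c \<bullet> v) * (c \<bullet> w))"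
proof -
  have "g *v w = (a \<bullet> w) *\<^sub>R a + ((p * (b \<bullet> w)) *\<^sub>R b + (q * (c \<bullet> w)) *\<^sub>R c)"
    by (simp add: vec_eq_iff matrix_vector_mult_def assms inner_vec_def sum_distrib_left
        sum_distrib_right sum.distrib algebra_simps)
  then show ?thesis by (simp add: inner_add_right inner_commute algebra_simps)
qed

text \<open>Gradients are written as explicit vectors, so that partial derivatives are their components and
  directional derivatives are inner products.\<close>

definition grad_t :: "real^3 \<Rightarrow> real^3" where
  "grad_t y = vector [1 / y $ 2, - t_of y / y $ 2, 0]"

definition grad_f :: "(real \<Rightarrow> real) \<Rightarrow> real^3 \<Rightarrow> real^3" where
  "grad_f Z y = vector [deriv Z (t_of y) / y $ 3,
     (Z (t_of y) - t_of y * deriv Z (t_of y)) / y $ 3, - f_of Z y / y $ 3]"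

definition grad_F :: "(real \<Rightarrow> real) \<Rightarrow> (real \<Rightarrow> real) \<Rightarrow> real^3 \<Rightarrow> real^3" where
  "grad_F U Z y = vector [deriv U (f_of Z y) * deriv Z (t_of y),
     deriv U (f_of Z y) * (Z (t_of y) - t_of y * deriv Z (t_of y)),
     U (f_of Z y) - f_of Z y * deriv U (f_of Z y)]"

lemma inner_vector_3: "(vector [a, b, c] :: real^3) \<bullet> h = a * h $ 1 + b * h $ 2 + c * h $ 3"
  by (simp add: inner_vec_def sum_3)

locale uz_function =
  fixes V :: "(real^3) set" and F :: "real^3 \<Rightarrow> real" and U Z :: "real \<Rightarrow> real"
  assumes uz: "uz_finsler_function V F U Z"
begin

lemma open_V: "open V"
  and connected_V: "connected V"
  and y2_pos: "y \<in> V \<Longrightarrow> y $ 2 > 0"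
  and y3_pos: "y \<in> V \<Longrightarrow> y $ 3 > 0"
  and f_nonzero: "y \<in> V \<Longrightarrow> f_of Z y \<noteq> 0"
  and F_eq: "y \<in> V \<Longrightarrow> F y = y $ 3 * U (f_of Z y)"
  and F_pos: "y \<in> V \<Longrightarrow> F y > 0"
  and metric_pos: "y \<in> V \<Longrightarrow> v \<noteq> 0 \<Longrightarrow> v \<bullet> (metric_tensor F y *v v) > 0"
  and Ck_U: "Ck_on 4 (f_values V Z) U"
  and Ck_Z: "Ck_on 4 (t_values V) Z"
  using uz by (auto simp: uz_finsler_function_def finsler_metric_function_def)

lemma f_in: "y \<in> V \<Longrightarrow> f_of Z y \<in> f_values V Z" and t_in: "y \<in> V \<Longrightarrow> t_of y \<in> t_values V"
  by (auto simp: f_values_def t_values_def)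

lemma Z_nonzero: "y \<in> V \<Longrightarrow> Z (t_of y) \<noteq> 0"
  using f_nonzero[of y] by (auto simp: f_of_def)

lemma U_pos: "y \<in> V \<Longrightarrow> U (f_of Z y) > 0"
  using F_pos[of y] F_eq[of y] y3_pos[of y] by (simp add: zero_less_mult_iff)

lemma has_derivative_t_of: "y \<in> V \<Longrightarrow> (t_of has_derivative (\<lambda>h. grad_t y \<bullet> h)) (at y)"
  using y2_pos[of y] unfolding t_of_def[abs_def]
  by (auto intro!: derivative_eq_intros has_derivative_coordinate
      simp: grad_t_def t_of_def inner_vector_3 fun_eq_iff field_simps)

lemma continuous_on_t_of: "continuous_on V t_of"
  using has_derivative_t_of by (meson continuous_at_imp_continuous_on has_derivative_continuous)

text \<open>Moving a point of the domain along \<open>y\<^sup>1\<close> alone gives \<open>t = y\<^sup>1 / y\<^sup>2\<close> all neighbouring values.\<close>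

lemma open_t_values: "open (t_values V)"
proof (subst open_subopen, intro ballI)
  fix t0 assume "t0 \<in> t_values V"
  then obtain y where y: "y \<in> V" "t_of y = t0" by (auto simp: t_values_def)
  define c where "c t = (vector [t * y $ 2, y $ 2, y $ 3] :: real^3)" for t
  have c: "c t = (t * y $ 2) *\<^sub>R axis 1 1 + (y $ 2) *\<^sub>R axis 2 1 + (y $ 3) *\<^sub>R axis 3 1" for t
    by (simp add: c_def vec_eq_iff forall_3 axis_def)
  have "continuous_on UNIV c"
    unfolding c[abs_def] by (intro continuous_intros)
  then have "open (c -` V)" using open_V by (simp add: open_vimage)
  moreover have "c t0 = y"
    using y y2_pos[of y] by (auto simp: c_def vec_eq_iff forall_3 t_of_def)
  moreover have "t_of (c t) = t" for t
    using y y2_pos[of y] by (simp add: c_def t_of_def)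
  ultimately show "\<exists>T. open T \<and> t0 \<in> T \<and> T \<subseteq> t_values V"
    using y(1) unfolding t_values_def
    by (intro exI[of _ "c -` V"]) (metis imageI subsetI vimageE vimageI)
qed

lemma connected_t_values: "connected (t_values V)"
  unfolding t_values_def by (rule connected_continuous_image[OF continuous_on_t_of connected_V])

lemma Z_derivs:
  "t \<in> t_values V \<Longrightarrow> (Z has_real_derivative deriv Z t) (at t)"
  "t \<in> t_values V \<Longrightarrow> (deriv Z has_real_derivative deriv (deriv Z) t) (at t)"
  "Ck_on 2 (t_values V) (deriv (deriv Z))"
  using Ck_on_real_SucD[OF open_t_values, of 3 Z] Ck_Z
    Ck_on_real_SucD[OF open_t_values, of 2 "deriv Z"] by (auto simp: eval_nat_numeral simp del: Ck_on.simps)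

lemma has_derivative_f_of:
  assumes y: "y \<in> V"
  shows "(f_of Z has_derivative (\<lambda>h. grad_f Z y \<bullet> h)) (at y)"
proof -
  have "((\<lambda>v. Z (t_of v)) has_derivative (\<lambda>h. (grad_t y \<bullet> h) * deriv Z (t_of y))) (at y)"
    by (rule DERIV_compose_FDERIV[OF Z_derivs(1)[OF t_in[OF y]] has_derivative_t_of[OF y]])
  then show ?thesis
    unfolding f_of_def[abs_def]
    using y2_pos[OF y] y3_pos[OF y]
    by (auto intro!: derivative_eq_intros has_derivative_coordinate
        simp: grad_f_def grad_t_def f_of_def inner_vector_3 fun_eq_iff field_simps)
qed

lemma continuous_on_f_of: "continuous_on V (f_of Z)"
  using has_derivative_f_of by (meson continuous_at_imp_continuous_on has_derivative_continuous)

text \<open>Scaling \<open>(y\<^sup>1, y\<^sup>2)\<close> leaves \<open>t\<close> fixed and scales \<open>f\<close>; since \<open>f\<close> never vanishes this reaches all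
  neighbouring values.\<close>

lemma open_f_values: "open (f_values V Z)"
proof (subst open_subopen, intro ballI)
  fix f0 assume "f0 \<in> f_values V Z"
  then obtain y where y: "y \<in> V" "f_of Z y = f0" by (auto simp: f_values_def)
  define c where "c f = (vector [f / f0 * y $ 1, f / f0 * y $ 2, y $ 3] :: real^3)" for f
  have c: "c f = (f / f0 * y $ 1) *\<^sub>R axis 1 1 + (f / f0 * y $ 2) *\<^sub>R axis 2 1
      + (y $ 3) *\<^sub>R axis 3 1" for f
    by (simp add: c_def vec_eq_iff forall_3 axis_def)
  have f0: "f0 \<noteq> 0" using f_nonzero y by auto
  have "continuous_on UNIV c"
    unfolding c[abs_def] by (intro continuous_intros) (use f0 in auto)
  then have "open (c -` V)" using open_V by (simp add: open_vimage)
  moreover have "c f0 = y"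
    using f0 by (auto simp: c_def vec_eq_iff forall_3)
  moreover have "f_of Z (c f) = f" if "c f \<in> V" for f
  proof -
    have "f / f0 * y $ 2 > 0" using y2_pos[OF that] by (simp add: c_def)
    then have "f \<noteq> 0" by auto
    then show ?thesis
      using y f0 y2_pos[OF y(1)] y3_pos[OF y(1)] by (auto simp: c_def f_of_def t_of_def)
  qed
  ultimately show "\<exists>T. open T \<and> f0 \<in> T \<and> T \<subseteq> f_values V Z"
    using y(1) unfolding f_values_def
    by (intro exI[of _ "c -` V"]) (metis imageI subsetI vimageE vimageI)
qed

lemma U_derivs:
  "f \<in> f_values V Z \<Longrightarrow> (U has_real_derivative deriv U f) (at f)"
  "f \<in> f_values V Z \<Longrightarrow> (deriv U has_real_derivative deriv (deriv U) f) (at f)"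
  using Ck_on_real_SucD[OF open_f_values, of 3 U] Ck_U
    Ck_on_real_SucD[OF open_f_values, of 2 "deriv U"] by (auto simp: eval_nat_numeral simp del: Ck_on.simps)

lemma has_derivative_U_f:
  assumes y: "y \<in> V"
  shows "((\<lambda>v. U (f_of Z v)) has_derivative (\<lambda>h. (grad_f Z y \<bullet> h) * deriv U (f_of Z y))) (at y)"
    "((\<lambda>v. deriv U (f_of Z v)) has_derivative
       (\<lambda>h. (grad_f Z y \<bullet> h) * deriv (deriv U) (f_of Z y))) (at y)"
  by (rule DERIV_compose_FDERIV[OF U_derivs(1)[OF f_in[OF y]] has_derivative_f_of[OF y]]
      DERIV_compose_FDERIV[OF U_derivs(2)[OF f_in[OF y]] has_derivative_f_of[OF y]])+

lemma has_derivative_Z_t: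
  assumes y: "y \<in> V"
  shows "((\<lambda>v. Z (t_of v)) has_derivative (\<lambda>h. (grad_t y \<bullet> h) * deriv Z (t_of y))) (at y)"
    "((\<lambda>v. deriv Z (t_of v)) has_derivative
       (\<lambda>h. (grad_t y \<bullet> h) * deriv (deriv Z) (t_of y))) (at y)"
  by (rule DERIV_compose_FDERIV[OF Z_derivs(1)[OF t_in[OF y]] has_derivative_t_of[OF y]]
      DERIV_compose_FDERIV[OF Z_derivs(2)[OF t_in[OF y]] has_derivative_t_of[OF y]])+

lemma has_derivative_F:
  assumes y: "y \<in> V"
  shows "(F has_derivative (\<lambda>h. grad_F U Z y \<bullet> h)) (at y)"
proof -
  have "((\<lambda>v. v $ 3 * U (f_of Z v)) has_derivative (\<lambda>h. grad_F U Z y \<bullet> h)) (at y)"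
    by (rule has_derivative_eq_rhs[OF has_derivative_mult[OF has_derivative_coordinate
            has_derivative_U_f(1)[OF y]]])
      (use y3_pos[OF y] in \<open>simp add: grad_F_def grad_f_def inner_vector_3 fun_eq_iff field_simps\<close>)
  then show ?thesis
    by (rule has_derivative_transform_within_open[OF _ open_V y]) (simp add: F_eq)
qed

text \<open>The components of \<open>grad_F\<close> are those of the gradient of \<open>z U(P / z)\<close> with \<open>P = y\<^sup>2 Z(t)\<close>. The Hessian of
  \<open>P\<close> is \<open>y\<^sup>2 Z'' t\<^sub>i t\<^sub>j\<close>, because by homogeneity it annihilates the radial direction; the rest of
  the Hessian of \<open>F\<close> comes from \<open>U''\<close>.\<close>

lemma has_derivative_grad_F:
  assumes y: "y \<in> V"
  shows "((\<lambda>v. grad_F U Z v $ j) has_derivative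
    (\<lambda>h. y $ 3 * deriv (deriv U) (f_of Z y) * grad_f Z y $ j * (grad_f Z y \<bullet> h)
       + deriv U (f_of Z y) * deriv (deriv Z) (t_of y) * y $ 2 * grad_t y $ j * (grad_t y \<bullet> h)))
    (at y)"
proof -
  note D = has_derivative_U_f[OF y] has_derivative_Z_t[OF y] has_derivative_t_of[OF y]
    has_derivative_f_of[OF y]
  have g: "y $ 3 * grad_f Z y $ 1 = deriv Z (t_of y)"
    "y $ 3 * grad_f Z y $ 2 = Z (t_of y) - t_of y * deriv Z (t_of y)"
    "y $ 3 * grad_f Z y $ 3 = - f_of Z y"
    "y $ 2 * grad_t y $ 1 = 1" "y $ 2 * grad_t y $ 2 = - t_of y" "y $ 2 * grad_t y $ 3 = 0"
    using y2_pos[OF y] y3_pos[OF y] by (auto simp: grad_f_def grad_t_def)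
  have "((\<lambda>v. grad_F U Z v $ j) has_derivative
    (\<lambda>h. deriv (deriv U) (f_of Z y) * (y $ 3 * grad_f Z y $ j) * (grad_f Z y \<bullet> h)
       + deriv U (f_of Z y) * deriv (deriv Z) (t_of y) * (y $ 2 * grad_t y $ j) * (grad_t y \<bullet> h)))
    (at y)"
    using exhaust_3[of j]
  proof (elim disjE)
    assume j: "j = 1"
    show ?thesis unfolding j g grad_F_def vector_3
      by (auto intro!: derivative_eq_intros D simp: fun_eq_iff algebra_simps)
  next
    assume j: "j = 2"
    show ?thesis unfolding j g grad_F_def vector_3
      by (auto intro!: derivative_eq_intros D simp: fun_eq_iff algebra_simps)
  next
    assume j: "j = 3"
    show ?thesis unfolding j g grad_F_def vector_3
      by (auto intro!: derivative_eq_intros D simp: fun_eq_iff algebra_simps)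
  qed
  then show ?thesis by (simp add: mult_ac)
qed

lemma metric_tensor_eq:
  assumes y: "y \<in> V"
  shows "metric_tensor F y $ i $ j = grad_F U Z y $ i * grad_F U Z y $ j +
    (F y * y $ 3 * deriv (deriv U) (f_of Z y) * grad_f Z y $ i * grad_f Z y $ j +
     F y * y $ 2 * deriv U (f_of Z y) * deriv (deriv Z) (t_of y) * grad_t y $ i * grad_t y $ j)"
proof -
  have "partial j (\<lambda>v. (F v)\<^sup>2) v = (2 * F v) * grad_F U Z v $ j" if "v \<in> V" for v
  proof -
    have "((\<lambda>v. (F v)\<^sup>2) has_derivative (\<lambda>h. ((2 * F v) *\<^sub>R grad_F U Z v) \<bullet> h)) (at v)"
      by (auto intro!: derivative_eq_intros has_derivative_F[OF that])
    from partial_eq_nth[OF this] show ?thesis by simp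
  qed
  then have "partial i (partial j (\<lambda>v. (F v)\<^sup>2)) y = partial i (\<lambda>v. (2 * F v) * grad_F U Z v $ j) y"
    by (rule partial_cong_open[OF open_V y])
  also have "((\<lambda>v. (2 * F v) * grad_F U Z v $ j) has_derivative
    (\<lambda>h. (2 *\<^sub>R (grad_F U Z y $ j *\<^sub>R grad_F U Z y +
     (F y * y $ 3 * deriv (deriv U) (f_of Z y) * grad_f Z y $ j) *\<^sub>R grad_f Z y +
     (F y * y $ 2 * deriv U (f_of Z y) * deriv (deriv Z) (t_of y) * grad_t y $ j) *\<^sub>R grad_t y)) \<bullet> h))
    (at y)"
    by (rule has_derivative_eq_rhs, rule has_derivative_mult[OF has_derivative_mult_right[OF
            has_derivative_F[OF y]] has_derivative_grad_F[OF y]])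
      (simp add: fun_eq_iff inner_add_left algebra_simps)
  from partial_eq_nth[OF this]
  have "partial i (\<lambda>v. (2 * F v) * grad_F U Z v $ j) y =
    2 * (grad_F U Z y $ j * grad_F U Z y $ i +
     (F y * y $ 3 * deriv (deriv U) (f_of Z y) * grad_f Z y $ j) * grad_f Z y $ i +
     (F y * y $ 2 * deriv U (f_of Z y) * deriv (deriv Z) (t_of y) * grad_t y $ j) * grad_t y $ i)"
    by simp
  finally show ?thesis by (simp add: metric_tensor_def algebra_simps)
qed

section \<open>The angle representation as two scalar equations\<close>

lemma metric_form_eq:
  assumes y: "y \<in> V"
  shows "v \<bullet> (metric_tensor F y *v w) = (grad_F U Z y \<bullet> v) * (grad_F U Z y \<bullet> w) +
    (F y * y $ 3 * deriv (deriv U) (f_of Z y) * (grad_f Z y \<bullet> v) * (grad_f Z y \<bullet> w) +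
     F y * y $ 2 * deriv U (f_of Z y) * deriv (deriv Z) (t_of y) * (grad_t y \<bullet> v) * (grad_t y \<bullet> w))"
  by (rule quadratic_form_of_sum_of_squares[OF metric_tensor_eq[OF y]])

text \<open>The radial vector \<open>y\<close> is annihilated by the gradients of \<open>f\<close> and \<open>t\<close> but not by that of \<open>F\<close>.
  Subtracting a multiple of it from \<open>w\<close> removes the square of the gradient of \<open>F\<close> from the quadratic form
  and leaves the other two squares unchanged.\<close>

lemma tangential_form_pos:
  assumes y: "y \<in> V" and w: "grad_f Z y \<bullet> w \<noteq> 0 \<or> grad_t y \<bullet> w \<noteq> 0"
  shows "F y * y $ 3 * deriv (deriv U) (f_of Z y) * (grad_f Z y \<bullet> w)\<^sup>2 +
     F y * y $ 2 * deriv U (f_of Z y) * deriv (deriv Z) (t_of y) * (grad_t y \<bullet> w)\<^sup>2 > 0"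
proof -
  have radial: "grad_t y \<bullet> y = 0" "grad_f Z y \<bullet> y = 0" "grad_F U Z y \<bullet> y = F y"
    using y2_pos[OF y] y3_pos[OF y]
    by (auto simp: grad_t_def grad_f_def grad_F_def inner_vector_3 F_eq[OF y] t_of_def f_of_def
        field_simps)
  define v where "v = w - ((grad_F U Z y \<bullet> w) / F y) *\<^sub>R y"
  have v: "grad_t y \<bullet> v = grad_t y \<bullet> w" "grad_f Z y \<bullet> v = grad_f Z y \<bullet> w" "grad_F U Z y \<bullet> v = 0"
    using F_pos[OF y] by (simp_all add: v_def inner_diff_right radial)
  then have "v \<noteq> 0" using w by auto
  from metric_pos[OF y this] show ?thesis
    unfolding metric_form_eq[OF y] v by (simp add: power2_eq_square mult_ac)
qed

lemma deriv2_U_pos: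
  assumes y: "y \<in> V"
  shows "deriv (deriv U) (f_of Z y) > 0"
proof -
  have "grad_f Z y \<bullet> axis 3 1 = - f_of Z y / y $ 3" "grad_t y \<bullet> axis 3 1 = 0"
    by (simp_all add: grad_f_def grad_t_def inner_axis)
  then show ?thesis
    using tangential_form_pos[OF y, of "axis 3 1"] F_pos[OF y] y3_pos[OF y] f_nonzero[OF y]
    by (auto simp: zero_less_mult_iff zero_less_divide_iff power2_eq_square)
qed

text \<open>The vector \<open>w\<close> below is tangent to the level set of \<open>f\<close> but not to that of \<open>t\<close>, so it isolates the second
  square.\<close>

lemma deriv_U_deriv2_Z_pos:
  assumes y: "y \<in> V"
  shows "deriv U (f_of Z y) * deriv (deriv Z) (t_of y) > 0"
proof -
  define w :: "real^3" where "w = vector [1, 0, deriv Z (t_of y) / f_of Z y]"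
  have "grad_f Z y \<bullet> w = 0" "grad_t y \<bullet> w = 1 / y $ 2"
    using f_nonzero[OF y] by (simp_all add: grad_f_def grad_t_def inner_vector_3 w_def)
  then have "0 < F y * (deriv U (f_of Z y) * deriv (deriv Z) (t_of y)) / y $ 2"
    using tangential_form_pos[OF y, of w] y2_pos[OF y] by (simp add: power2_eq_square mult_ac)
  then have "0 < F y * (deriv U (f_of Z y) * deriv (deriv Z) (t_of y))"
    by (simp only: pos_less_divide_eq[OF y2_pos[OF y]] mult_zero_left)
  then show ?thesis using zero_less_mult_pos[OF _ F_pos[OF y]] by blast
qed

lemma f_over_Z: "y \<in> V \<Longrightarrow> f_of Z y / Z (t_of y) = y $ 2 / y $ 3"
  using Z_nonzero[of y] by (simp add: f_of_def)

lemma separated_product_pos: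
  assumes y: "y \<in> V"
  shows "(1 / U (f_of Z y) * deriv U (f_of Z y) * f_of Z y) *
    (deriv (deriv Z) (t_of y) / Z (t_of y)) > 0"
proof -
  have "(1 / U (f_of Z y) * deriv U (f_of Z y) * f_of Z y) *
    (deriv (deriv Z) (t_of y) / Z (t_of y)) =
    (deriv U (f_of Z y) * deriv (deriv Z) (t_of y)) * (f_of Z y / Z (t_of y)) / U (f_of Z y)"
    by (simp add: mult_ac)
  moreover have "\<dots> > 0"
    unfolding f_over_Z[OF y]
    by (rule divide_pos_pos[OF mult_pos_pos[OF deriv_U_deriv2_Z_pos[OF y]
            divide_pos_pos[OF y2_pos[OF y] y3_pos[OF y]]] U_pos[OF y]])
  ultimately show ?thesis by (simp only:)
qed

lemma has_derivative_angles:
  assumes y: "y \<in> V"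
  shows "(\<theta> has_real_derivative d) (at (f_of Z y)) \<Longrightarrow>
      ((\<lambda>v. \<theta> (f_of Z v)) has_derivative (\<lambda>h. (d *\<^sub>R grad_f Z y) \<bullet> h)) (at y)"
    and "(\<phi> has_real_derivative d) (at (t_of y)) \<Longrightarrow>
      ((\<lambda>v. \<phi> (t_of v)) has_derivative (\<lambda>h. (d *\<^sub>R grad_t y) \<bullet> h)) (at y)"
  using DERIV_compose_FDERIV[OF _ has_derivative_f_of[OF y]]
    DERIV_compose_FDERIV[OF _ has_derivative_t_of[OF y]] by (simp_all add: mult.commute)

text \<open>Both sides of the angle representation are combinations of \<open>F\<^sub>i F\<^sub>j\<close>, \<open>f\<^sub>i f\<^sub>j\<close> and \<open>t\<^sub>i t\<^sub>j\<close> with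
  the same first coefficient. As \<open>t\<^sub>3 = 0\<close>, the component \<open>33\<close> compares the coefficients of \<open>f\<^sub>i f\<^sub>j\<close>, and then
  the component \<open>11\<close> those of \<open>t\<^sub>i t\<^sub>j\<close>.\<close>

lemma angle_representation_iff:
  assumes H: "H > 0"
    and \<theta>: "\<And>f. f \<in> f_values V Z \<Longrightarrow> (\<theta> has_real_derivative deriv \<theta> f) (at f)"
    and \<phi>: "\<And>t. t \<in> t_values V \<Longrightarrow> (\<phi> has_real_derivative deriv \<phi> t) (at t)"
  shows "angle_representation V F H (\<lambda>y. \<theta> (f_of Z y)) (\<lambda>y. \<phi> (t_of y)) \<longleftrightarrow>
    (\<forall>y\<in>V. (deriv \<theta> (f_of Z y))\<^sup>2 = H\<^sup>2 * (1 / U (f_of Z y)) * deriv (deriv U) (f_of Z y) \<and>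
      (deriv \<phi> (t_of y))\<^sup>2 * (sin (\<theta> (f_of Z y)))\<^sup>2 =
        H\<^sup>2 * (1 / U (f_of Z y) * deriv U (f_of Z y) * f_of Z y) *
          (deriv (deriv Z) (t_of y) / Z (t_of y)))"
  unfolding angle_representation_def
proof (intro ball_cong refl)
  fix y assume y: "y \<in> V"
  let ?f = "f_of Z y" and ?t = "t_of y"
  define P P' Q Q' where "P = F y * y $ 3 * deriv (deriv U) ?f"
    and "P' = (F y)\<^sup>2 / H\<^sup>2 * (deriv \<theta> ?f)\<^sup>2"
    and "Q = F y * y $ 2 * deriv U ?f * deriv (deriv Z) ?t"
    and "Q' = (F y)\<^sup>2 / H\<^sup>2 * ((deriv \<phi> ?t)\<^sup>2 * (sin (\<theta> ?f))\<^sup>2)"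
  have pt: "partial i F y = grad_F U Z y $ i"
      "partial i (\<lambda>y. \<theta> (f_of Z y)) y = deriv \<theta> ?f * grad_f Z y $ i"
      "partial i (\<lambda>y. \<phi> (t_of y)) y = deriv \<phi> ?t * grad_t y $ i" for i
    using partial_eq_nth[OF has_derivative_F[OF y]]
      partial_eq_nth[OF has_derivative_angles(1)[OF y \<theta>[OF f_in[OF y]]]]
      partial_eq_nth[OF has_derivative_angles(2)[OF y \<phi>[OF t_in[OF y]]]] by simp_all
  have "(\<forall>i j. metric_tensor F y $ i $ j = partial i F y * partial j F y +
      1 / H\<^sup>2 * (partial i (\<lambda>y. \<theta> (f_of Z y)) y * partial j (\<lambda>y. \<theta> (f_of Z y)) y +
        (sin (\<theta> (f_of Z y)))\<^sup>2 * (partial i (\<lambda>y. \<phi> (t_of y)) y * partial j (\<lambda>y. \<phi> (t_of y)) y)) *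
        (F y)\<^sup>2) \<longleftrightarrow>
    (\<forall>i j. P * grad_f Z y $ i * grad_f Z y $ j + Q * grad_t y $ i * grad_t y $ j =
       P' * grad_f Z y $ i * grad_f Z y $ j + Q' * grad_t y $ i * grad_t y $ j)"
    unfolding pt metric_tensor_eq[OF y] P_def P'_def Q_def Q'_def
    by (simp add: power2_eq_square algebra_simps)
  also have "\<dots> \<longleftrightarrow> P = P' \<and> Q = Q'"
  proof
    assume *: "\<forall>i j. P * grad_f Z y $ i * grad_f Z y $ j + Q * grad_t y $ i * grad_t y $ j =
       P' * grad_f Z y $ i * grad_f Z y $ j + Q' * grad_t y $ i * grad_t y $ j"
    have "grad_f Z y $ 3 \<noteq> 0" "grad_t y $ 3 = 0" "grad_t y $ 1 \<noteq> 0"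
      using f_nonzero[OF y] y2_pos[OF y] y3_pos[OF y] by (auto simp: grad_f_def grad_t_def)
    with *[rule_format, of 3 3] *[rule_format, of 1 1] show "P = P' \<and> Q = Q'" by simp
  qed auto
  also have "P = P' \<longleftrightarrow> (deriv \<theta> ?f)\<^sup>2 = H\<^sup>2 * (1 / U ?f) * deriv (deriv U) ?f"
    using H U_pos[OF y] y3_pos[OF y]
    by (auto simp: P_def P'_def F_eq[OF y] power2_eq_square field_simps)
  also have "Q = Q' \<longleftrightarrow> (deriv \<phi> ?t)\<^sup>2 * (sin (\<theta> ?f))\<^sup>2 =
      H\<^sup>2 * (1 / U ?f * deriv U ?f * ?f) * (deriv (deriv Z) ?t / Z ?t)"
  proof -
    have e: "H\<^sup>2 * (1 / U ?f * deriv U ?f * ?f) * (deriv (deriv Z) ?t / Z ?t) =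
        H\<^sup>2 * (1 / U ?f * deriv U ?f) * deriv (deriv Z) ?t * (?f / Z ?t)" by simp
    show ?thesis
      unfolding e f_over_Z[OF y] using H U_pos[OF y] y3_pos[OF y]
      by (auto simp: Q_def Q'_def F_eq[OF y] power2_eq_square field_simps)
  qed
  finally show "(\<forall>i j. metric_tensor F y $ i $ j = partial i F y * partial j F y +
      1 / H\<^sup>2 * (partial i (\<lambda>y. \<theta> (f_of Z y)) y * partial j (\<lambda>y. \<theta> (f_of Z y)) y +
        (sin (\<theta> (f_of Z y)))\<^sup>2 * (partial i (\<lambda>y. \<phi> (t_of y)) y * partial j (\<lambda>y. \<phi> (t_of y)) y)) *
        (F y)\<^sup>2) \<longleftrightarrow>
     (deriv \<theta> ?f)\<^sup>2 = H\<^sup>2 * (1 / U ?f) * deriv (deriv U) ?f \<and>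
      (deriv \<phi> ?t)\<^sup>2 * (sin (\<theta> ?f))\<^sup>2 =
        H\<^sup>2 * (1 / U ?f * deriv U ?f * ?f) * (deriv (deriv Z) ?t / Z ?t)" .
qed

section \<open>The indicatrix in the angular coordinates\<close>

lemma azimuthal_angleD:
  assumes "azimuthal_angle V Z \<theta>"
  shows "Ck_on 3 (f_values V Z) \<theta>" "inj_on \<theta> (f_values V Z)"
    "\<And>y. y \<in> V \<Longrightarrow> sin (\<theta> (f_of Z y)) \<noteq> 0"
    "\<And>f. f \<in> f_values V Z \<Longrightarrow> (\<theta> has_real_derivative deriv \<theta> f) (at f)"
  using assms f_in Ck_on_real_SucD(1)[OF open_f_values, of 2 \<theta>]
  by (auto simp: azimuthal_angle_def eval_nat_numeral simp del: Ck_on.simps)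

lemma polar_angleD:
  assumes "polar_angle V \<phi>"
  shows "Ck_on 3 (t_values V) \<phi>" "inj_on \<phi> (t_values V)"
    "\<And>t. t \<in> t_values V \<Longrightarrow> (\<phi> has_real_derivative deriv \<phi> t) (at t)"
    "Ck_on 2 (t_values V) (deriv \<phi>)"
  using assms Ck_on_real_SucD[OF open_t_values, of 2 \<phi>]
  by (auto simp: polar_angle_def eval_nat_numeral simp del: Ck_on.simps)

text \<open>By positive definiteness of the metric tensor; this makes the angles invertible with inverses of
  the same class.\<close>

lemma deriv_angles_nonzero:
  assumes H: "H > 0" and az: "azimuthal_angle V Z \<theta>" and po: "polar_angle V \<phi>"
    and rep: "angle_representation V F H (\<lambda>y. \<theta> (f_of Z y)) (\<lambda>y. \<phi> (t_of y))"
  shows "f \<in> f_values V Z \<Longrightarrow> deriv \<theta> f \<noteq> 0" "t \<in> t_values V \<Longrightarrow> deriv \<phi> t \<noteq> 0"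
proof -
  have eq: "(deriv \<theta> (f_of Z y))\<^sup>2 = H\<^sup>2 * (1 / U (f_of Z y)) * deriv (deriv U) (f_of Z y)"
    "(deriv \<phi> (t_of y))\<^sup>2 * (sin (\<theta> (f_of Z y)))\<^sup>2 =
        H\<^sup>2 * (1 / U (f_of Z y) * deriv U (f_of Z y) * f_of Z y) *
          (deriv (deriv Z) (t_of y) / Z (t_of y))" if "y \<in> V" for y
    using iffD1[OF angle_representation_iff[OF H azimuthal_angleD(4)[OF az]
          polar_angleD(3)[OF po]] rep] that by blast+
  have "deriv \<theta> (f_of Z y) \<noteq> 0" if y: "y \<in> V" for y
    using eq(1)[OF y] H U_pos[OF y] deriv2_U_pos[OF y] by auto
  then show "f \<in> f_values V Z \<Longrightarrow> deriv \<theta> f \<noteq> 0" by (auto simp: f_values_def)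
  have "deriv \<phi> (t_of y) \<noteq> 0" if y: "y \<in> V" for y
  proof
    assume "deriv \<phi> (t_of y) = 0"
    then have "0 = H\<^sup>2 * ((1 / U (f_of Z y) * deriv U (f_of Z y) * f_of Z y) *
          (deriv (deriv Z) (t_of y) / Z (t_of y)))"
      using eq(2)[OF y] unfolding mult.assoc[of "H\<^sup>2"] by simp
    moreover have "\<dots> > 0"
      by (rule mult_pos_pos[OF _ separated_product_pos[OF y]]) (use H in simp)
    ultimately show False by (simp only: less_irrefl)
  qed
  then show "t \<in> t_values V \<Longrightarrow> deriv \<phi> t \<noteq> 0" by (auto simp: t_values_def)
qed

text \<open>The chart itself is never differentiated explicitly: in coordinates where \<open>\<theta>\<close> and \<open>\<phi>\<close> are the coordinate
  functions and \<open>F\<close> is constant, the chain rule gives the values of their three differentials on the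
  coordinate vectors.\<close>

lemma induced_metric_round:
  assumes H: "H > 0" and az: "azimuthal_angle V Z \<theta>" and po: "polar_angle V \<phi>"
    and rep: "angle_representation V F H (\<lambda>y. \<theta> (f_of Z y)) (\<lambda>y. \<phi> (t_of y))"
    and W: "open W" "u \<in> W" and \<Phi>: "(\<Phi> has_derivative D) (at u)" "\<Phi> ` W \<subseteq> V"
    and coord: "\<And>v. v \<in> W \<Longrightarrow> F (\<Phi> v) = 1" "\<And>v. v \<in> W \<Longrightarrow> \<theta> (f_of Z (\<Phi> v)) = v $ 1"
      "\<And>v. v \<in> W \<Longrightarrow> \<phi> (t_of (\<Phi> v)) = v $ 2"
  shows "inj D" "induced_metric (metric_tensor F) \<Phi> u = round_metric H (u $ 1)"
proof -
  let ?y = "\<Phi> u"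
  have y: "?y \<in> V" using W \<Phi>(2) by auto
  note D\<theta> = has_derivative_angles(1)[OF y azimuthal_angleD(4)[OF az f_in[OF y]]]
    and D\<phi> = has_derivative_angles(2)[OF y polar_angleD(3)[OF po t_in[OF y]]]
  have chain: "g \<bullet> D h = L h"
    if "(\<psi> has_derivative (\<lambda>h. g \<bullet> h)) (at ?y)" "(c has_derivative L) (at u)"
      "\<And>v. v \<in> W \<Longrightarrow> \<psi> (\<Phi> v) = c v" for \<psi> :: "real^3 \<Rightarrow> real" and c g L h
  proof -
    have "(c has_derivative (\<lambda>h. g \<bullet> D h)) (at u)"
      by (rule has_derivative_transform_within_open[OF has_derivative_compose[OF \<Phi>(1) that(1)] W that(3)])
    from has_derivative_unique[OF this that(2)] show ?thesis by (simp add: fun_eq_iff)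
  qed
  have dF: "grad_F U Z ?y \<bullet> D h = 0" for h
    using chain[OF has_derivative_F[OF y] has_derivative_const coord(1)] .
  have d\<theta>: "(deriv \<theta> (f_of Z ?y) *\<^sub>R grad_f Z ?y) \<bullet> D h = h $ 1" for h
    using chain[OF D\<theta> has_derivative_coordinate coord(2)] .
  have d\<phi>: "(deriv \<phi> (t_of ?y) *\<^sub>R grad_t ?y) \<bullet> D h = h $ 2" for h
    using chain[OF D\<phi> has_derivative_coordinate coord(3)] .
  have lin: "linear D" using \<Phi>(1) has_derivative_linear by blast
  have "h = 0" if "D h = 0" for h
    using d\<theta>[of h] d\<phi>[of h] that by (simp add: vec_eq_iff forall_2)
  then show "inj D" using linear_injective_0[OF lin] by blast
  have form: "v \<bullet> (metric_tensor F ?y *v w) = (grad_F U Z ?y \<bullet> v) * (grad_F U Z ?y \<bullet> w) +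
    (1 / H\<^sup>2 * ((deriv \<theta> (f_of Z ?y) *\<^sub>R grad_f Z ?y) \<bullet> v) * ((deriv \<theta> (f_of Z ?y) *\<^sub>R grad_f Z ?y) \<bullet> w) +
     (sin (u $ 1))\<^sup>2 / H\<^sup>2 * ((deriv \<phi> (t_of ?y) *\<^sub>R grad_t ?y) \<bullet> v) *
       ((deriv \<phi> (t_of ?y) *\<^sub>R grad_t ?y) \<bullet> w))" for v w
    using rep y coord W(2)
    by (intro quadratic_form_of_sum_of_squares)
      (simp add: angle_representation_def partial_eq_nth[OF has_derivative_F[OF y]]
        partial_eq_nth[OF D\<theta>] partial_eq_nth[OF D\<phi>] algebra_simps)
  have D: "partial a \<Phi> u = D (axis a 1)" for a
    using frechet_derivative_at[OF \<Phi>(1)] by (simp add: partial_def)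
  show "induced_metric (metric_tensor F) \<Phi> u = round_metric H (u $ 1)"
    unfolding induced_metric_def form D dF d\<theta> d\<phi>
    by (simp add: vec_eq_iff forall_2 round_metric_def axis_def)
qed

text \<open>A single chart \<open>\<Phi>\<close> covers the indicatrix. It inverts the pair of angles: the angles give \<open>f\<close> and
  \<open>t\<close>, the condition \<open>F = 1\<close> gives \<open>z = 1 / U(f)\<close>, and then \<open>y\<^sup>2 = z f / Z(t)\<close> and \<open>y\<^sup>1 = t y\<^sup>2\<close>.\<close>

lemma has_constant_curvature_of_angle_representation:
  assumes H: "H > 0" and az: "azimuthal_angle V Z \<theta>" and po: "polar_angle V \<phi>"
    and rep: "angle_representation V F H (\<lambda>y. \<theta> (f_of Z y)) (\<lambda>y. \<phi> (t_of y))"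
  shows "has_constant_curvature (indicatrix V F) (metric_tensor F) (H\<^sup>2)"
proof -
  note \<theta> = azimuthal_angleD[OF az] and \<phi> = polar_angleD[OF po]
  note nz = deriv_angles_nonzero[OF H az po rep]
  define fi where "fi = the_inv_into (f_values V Z) \<theta>"
  define ti where "ti = the_inv_into (t_values V) \<phi>"
  have fi: "open (\<theta> ` f_values V Z)" "Ck_on 3 (\<theta> ` f_values V Z) fi"
    using Ck_on_the_inv_into[OF open_f_values _ \<theta>(2) nz(1), of 2] \<theta>(1)
    by (auto simp: fi_def eval_nat_numeral simp del: Ck_on.simps)
  have ti: "open (\<phi> ` t_values V)" "Ck_on 3 (\<phi> ` t_values V) ti"
    using Ck_on_the_inv_into[OF open_t_values _ \<phi>(2) nz(2), of 2] \<phi>(1)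
    by (auto simp: ti_def eval_nat_numeral simp del: Ck_on.simps)
  have fi_\<theta>: "fi (\<theta> (f_of Z y)) = f_of Z y" and ti_\<phi>: "ti (\<phi> (t_of y)) = t_of y" if "y \<in> V" for y
    using the_inv_into_f_f[OF \<theta>(2) f_in[OF that]] the_inv_into_f_f[OF \<phi>(2) t_in[OF that]]
    by (simp_all add: fi_def ti_def)
  define Q :: "(real^2) set" where
    "Q = (\<lambda>u. u $ 1) -` (\<theta> ` f_values V Z) \<inter> (\<lambda>u. u $ 2) -` (\<phi> ` t_values V)"
  define z where "z u = 1 / U (fi (u $ 1))" for u :: "real^2"
  define q where "q u = z u * fi (u $ 1) / Z (ti (u $ 2))" for u :: "real^2"
  define \<Phi> where "\<Phi> u = (ti (u $ 2) * q u) *\<^sub>R (axis 1 1 :: real^3) + q u *\<^sub>R axis 2 1 + z u *\<^sub>R axis 3 1"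
    for u :: "real^2"
  define \<Psi> where "\<Psi> y = \<theta> (f_of Z y) *\<^sub>R (axis 1 1 :: real^2) + \<phi> (t_of y) *\<^sub>R axis 2 1" for y
  have \<Phi>_nth: "\<Phi> u $ 1 = ti (u $ 2) * q u" "\<Phi> u $ 2 = q u" "\<Phi> u $ 3 = z u" for u
    by (simp_all add: \<Phi>_def axis_def)
  have \<Psi>_nth: "\<Psi> y $ 1 = \<theta> (f_of Z y)" "\<Psi> y $ 2 = \<phi> (t_of y)" for y
    by (simp_all add: \<Psi>_def axis_def)
  have Q: "open Q"
    unfolding Q_def by (intro open_Int open_vimage fi(1) ti(1) continuous_intros)
  have fiQ: "fi (u $ 1) \<in> f_values V Z" "\<theta> (fi (u $ 1)) = u $ 1"
    and tiQ: "ti (u $ 2) \<in> t_values V" "\<phi> (ti (u $ 2)) = u $ 2" if "u \<in> Q" for u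
    using that fi_\<theta> ti_\<phi> by (auto simp: Q_def f_values_def t_values_def)
  have U0: "U f > 0" if "f \<in> f_values V Z" for f using that U_pos by (auto simp: f_values_def)
  have Z0: "Z t \<noteq> 0" if "t \<in> t_values V" for t using that Z_nonzero by (auto simp: t_values_def)
  have Ck\<Phi>: "Ck_on 3 Q \<Phi>"
  proof -
    have c1: "Ck_on 3 Q (\<lambda>u. fi (u $ 1))"
      by (intro Ck_on_compose[OF Q fi(1,2)] Ck_on_bounded_linear[OF Q] bounded_linear_vec_nth)
        (auto simp: Q_def)
    have c2: "Ck_on 3 Q (\<lambda>u. ti (u $ 2))"
      by (intro Ck_on_compose[OF Q ti(1,2)] Ck_on_bounded_linear[OF Q] bounded_linear_vec_nth)
        (auto simp: Q_def)
    have c3: "Ck_on 3 Q (\<lambda>u. U (fi (u $ 1)))"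
      by (rule Ck_on_compose[OF Q open_f_values Ck_on_antimono[OF _ open_f_values Ck_U] c1])
        (use fiQ in auto)
    have c4: "Ck_on 3 Q (\<lambda>u. Z (ti (u $ 2)))"
      by (rule Ck_on_compose[OF Q open_t_values Ck_on_antimono[OF _ open_t_values Ck_Z] c2])
        (use tiQ in auto)
    have c5: "Ck_on 3 Q z"
      unfolding z_def[abs_def]
      by (rule Ck_on_divide[OF Q Ck_on_const[OF Q] c3]) (use U0[OF fiQ(1)] in force)
    have c6: "Ck_on 3 Q q"
      unfolding q_def[abs_def]
      by (rule Ck_on_divide[OF Q Ck_on_mult[OF Q c5 c1] c4]) (use Z0[OF tiQ(1)] in blast)
    show ?thesis
      unfolding \<Phi>_def[abs_def]
      by (intro Ck_on_add[OF Q] Ck_on_scaleR[OF Q] Ck_on_mult[OF Q] Ck_on_const[OF Q] c2 c5 c6)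
  qed
  define W where "W = Q \<inter> \<Phi> -` V"
  have W: "open W"
    unfolding W_def using Ck_on_imp_continuous_on[OF Ck\<Phi>] Q open_V
    by (simp add: continuous_open_preimage)
  have WV: "\<Phi> ` W \<subseteq> V" and WQ: "W \<subseteq> Q" by (auto simp: W_def)
  have on_W: "t_of (\<Phi> u) = ti (u $ 2)" "f_of Z (\<Phi> u) = fi (u $ 1)" "F (\<Phi> u) = 1" if u: "u \<in> W" for u
  proof -
    have uQ: "u \<in> Q" and V: "\<Phi> u \<in> V" using u by (auto simp: W_def)
    show t: "t_of (\<Phi> u) = ti (u $ 2)"
      using y2_pos[OF V] by (simp add: t_of_def \<Phi>_nth)
    have z: "z u > 0" using y3_pos[OF V] by (simp add: \<Phi>_nth)
    show f: "f_of Z (\<Phi> u) = fi (u $ 1)"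
      using z Z0[OF tiQ(1)[OF uQ]] by (simp add: f_of_def t \<Phi>_nth q_def)
    show "F (\<Phi> u) = 1"
      using U0[OF fiQ(1)[OF uQ]] by (simp add: F_eq[OF V] f \<Phi>_nth z_def)
  qed
  have \<Psi>\<Phi>: "\<Psi> (\<Phi> u) = u" if "u \<in> W" for u
    using on_W[OF that] fiQ(2) tiQ(2) that WQ by (auto simp: vec_eq_iff forall_2 \<Psi>_nth)
  have \<Phi>\<Psi>: "\<Psi> y \<in> W" "\<Phi> (\<Psi> y) = y" if "y \<in> indicatrix V F" for y
  proof -
    have y: "y \<in> V" "F y = 1" using that by (auto simp: indicatrix_def)
    have z: "z (\<Psi> y) = y $ 3"
      using y(2) U_pos[OF y(1)] by (simp add: z_def \<Psi>_nth fi_\<theta>[OF y(1)] F_eq[OF y(1)] field_simps)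
    have "q (\<Psi> y) = y $ 3 * (f_of Z y / Z (t_of y))"
      by (simp add: q_def z \<Psi>_nth fi_\<theta>[OF y(1)] ti_\<phi>[OF y(1)])
    then have "q (\<Psi> y) = y $ 2"
      using y3_pos[OF y(1)] unfolding f_over_Z[OF y(1)] by simp
    then show e: "\<Phi> (\<Psi> y) = y"
      using z y2_pos[OF y(1)]
      by (simp add: vec_eq_iff forall_3 \<Phi>_nth \<Psi>_nth ti_\<phi>[OF y(1)]) (simp add: t_of_def)
    show "\<Psi> y \<in> W"
      using y(1) f_in[OF y(1)] t_in[OF y(1)] by (simp add: W_def Q_def e \<Psi>_nth)
  qed
  have image: "\<Phi> ` W = indicatrix V F"
    using on_W(3) WV \<Phi>\<Psi> by (force simp: indicatrix_def)
  have "homeomorphism W (\<Phi> ` W) \<Phi> \<Psi>"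
  proof (rule homeomorphismI)
    show "continuous_on W \<Phi>"
      using Ck_on_imp_continuous_on[OF Ck\<Phi>] WQ continuous_on_subset by blast
    have "continuous_on V \<Psi>"
      unfolding \<Psi>_def[abs_def]
      using continuous_on_compose2[OF Ck_on_imp_continuous_on[OF \<theta>(1)] continuous_on_f_of]
        continuous_on_compose2[OF Ck_on_imp_continuous_on[OF \<phi>(1)] continuous_on_t_of] f_in t_in
      by (intro continuous_intros) auto
    then show "continuous_on (\<Phi> ` W) \<Psi>" using WV continuous_on_subset by blast
  qed (use \<Psi>\<Phi> \<Phi>\<Psi> image in auto)
  have D\<Phi>: "(\<Phi> has_derivative frechet_derivative \<Phi> (at u)) (at u)" if "u \<in> W" for u
    using Ck_on_SucD(1)[OF Q, of 2 \<Phi>] Ck\<Phi> that WQ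
    by (auto simp: eval_nat_numeral simp del: Ck_on.simps)
  have coord: "\<theta> (f_of Z (\<Phi> v)) = v $ 1" "\<phi> (t_of (\<Phi> v)) = v $ 2" if "v \<in> W" for v
    using on_W[OF that] fiQ(2) tiQ(2) that WQ by auto
  note round = induced_metric_round[OF H az po rep W _ D\<Phi> WV on_W(3) coord]
  have "surface_chart (indicatrix V F) W \<Phi>"
    unfolding surface_chart_def image
    using W Ck_on_subset[OF Ck\<Phi> WQ] round(1) \<open>homeomorphism W (\<Phi> ` W) \<Phi> \<Psi>\<close> image by auto
  moreover have "constant_curvature_metric W (induced_metric (metric_tensor F) \<Phi>) (H\<^sup>2)"
  proof (rule constant_curvature_round_metric[OF W])
    show "sin (u $ 1) \<noteq> 0" if "u \<in> W" for u
      using \<theta>(3)[of "\<Phi> u"] coord(1)[OF that] WV that by auto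
    show "induced_metric (metric_tensor F) \<Phi> u = round_metric H (u $ 1)" if "u \<in> W" for u
      using round(2) that by blast
  qed (use H in simp)
  ultimately show ?thesis
    unfolding has_constant_curvature_def image[symmetric] by blast
qed

section \<open>Separation of variables and the polar angle\<close>

text \<open>The domain need not be a product in the coordinates \<open>(f, t)\<close>, so the variables are separated
  only locally: near \<open>a\<close>, every \<open>b\<close> has a companion \<open>m b\<close> in the domain with the \<open>f\<close> of \<open>b\<close> and the \<open>t\<close> of
  \<open>a\<close>. Hence \<open>A\<close> is locally constant along the connected domain.\<close>

lemma separation_of_variables:
  assumes eq: "\<And>y. y \<in> V \<Longrightarrow> A (f_of Z y) = B (t_of y)"
  shows "\<exists>c::real. \<forall>f\<in>f_values V Z. A f = c"
proof -
  have "\<forall>\<^sub>F b in at a within V. A (f_of Z a) = A (f_of Z b)" if a: "a \<in> V" for a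
  proof -
    define q where "q b = f_of Z b * b $ 3 / Z (t_of a)" for b
    \<comment> \<open>The second component \<open>q b\<close> restores the value of \<open>f\<close> at \<open>b\<close> when \<open>t\<close> is that of \<open>a\<close>.\<close>
    define m :: "real^3 \<Rightarrow> real^3" where "m b =
      (t_of a * q b) *\<^sub>R axis 1 1 + q b *\<^sub>R axis 2 1 + (b $ 3) *\<^sub>R axis 3 1" for b
    have m: "m b $ 1 = t_of a * q b" "m b $ 2 = q b" "m b $ 3 = b $ 3" for b
      by (simp_all add: m_def axis_def)
    have "continuous_on V m"
      unfolding m_def[abs_def] q_def
      by (intro continuous_intros continuous_on_f_of) (use Z_nonzero[OF a] in auto)
    moreover have "m a = a"
      using y2_pos[OF a] y3_pos[OF a] Z_nonzero[OF a]
      by (simp add: vec_eq_iff forall_3 m q_def) (simp add: f_of_def t_of_def)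
    ultimately have "(m \<longlongrightarrow> a) (at a within V)"
      using a by (metis continuous_on_def)
    then have "\<forall>\<^sub>F b in at a within V. m b \<in> V"
      using open_V a by (rule topological_tendstoD)
    moreover have "\<forall>\<^sub>F b in at a within V. b \<in> V"
      by (simp add: eventually_at_filter)
    ultimately show ?thesis
    proof eventually_elim
      case (elim b)
      have t: "t_of (m b) = t_of a"
        using y2_pos[OF elim(1)] by (simp add: t_of_def m)
      have "f_of Z (m b) = f_of Z b"
        using y3_pos[OF elim(2)] Z_nonzero[OF a] by (simp add: f_of_def[of Z "m b"] t m q_def)
      then show ?case using eq[OF elim(1)] eq[OF a] by (simp add: t)
    qed
  qed
  then have "A (f_of Z a) = A (f_of Z b)" if "a \<in> V" "b \<in> V" for a b
    using connected_local_const[OF connected_V that, of "\<lambda>y. A (f_of Z y)"] by blast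
  then show ?thesis unfolding f_values_def by blast
qed

text \<open>With \<open>A = f U' / (U sin\<^sup>2 \<theta>)\<close> and \<open>B = \<phi>'\<^sup>2 Z / (H\<^sup>2 Z'')\<close>, the second scalar equation reads
  \<open>A(f) = B(t)\<close>.\<close>

lemma equations_of_angle_representation:
  assumes H: "H > 0" and az: "azimuthal_angle V Z \<theta>" and po: "polar_angle V \<phi>"
    and rep: "angle_representation V F H (\<lambda>y. \<theta> (f_of Z y)) (\<lambda>y. \<phi> (t_of y))"
  shows "\<exists>T. \<forall>f\<in>f_values V Z. (deriv \<theta> f)\<^sup>2 = H\<^sup>2 * (1 / U f) * deriv (deriv U) f \<and>
    1 / U f * deriv U f * f = T * (sin (\<theta> f))\<^sup>2"
proof -
  have eq: "(deriv \<theta> (f_of Z y))\<^sup>2 = H\<^sup>2 * (1 / U (f_of Z y)) * deriv (deriv U) (f_of Z y)"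
    "(deriv \<phi> (t_of y))\<^sup>2 * (sin (\<theta> (f_of Z y)))\<^sup>2 =
        H\<^sup>2 * (1 / U (f_of Z y) * deriv U (f_of Z y) * f_of Z y) *
          (deriv (deriv Z) (t_of y) / Z (t_of y))" if "y \<in> V" for y
    using iffD1[OF angle_representation_iff[OF H azimuthal_angleD(4)[OF az]
          polar_angleD(3)[OF po]] rep] that by blast+
  define A where "A f = 1 / U f * deriv U f * f / (sin (\<theta> f))\<^sup>2" for f
  define B where "B t = (deriv \<phi> t)\<^sup>2 / (H\<^sup>2 * (deriv (deriv Z) t / Z t))" for t
  have "A (f_of Z y) = B (t_of y)" if y: "y \<in> V" for y
  proof -
    have nz: "deriv (deriv Z) (t_of y) / Z (t_of y) \<noteq> 0"
      using deriv_U_deriv2_Z_pos[OF y] Z_nonzero[OF y] by auto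
    have ratio: "k / s = p / (h * r)" if "p * s = h * k * r" "s \<noteq> 0" "h \<noteq> 0" "r \<noteq> 0"
      for k s p h r :: real
      using that by (simp add: frac_eq_eq mult_ac)
    show ?thesis
      unfolding A_def B_def
      by (rule ratio[OF eq(2)[OF y] _ _ nz]) (use H azimuthal_angleD(3)[OF az y] in simp_all)
  qed
  then obtain T where T: "\<And>f. f \<in> f_values V Z \<Longrightarrow> A f = T"
    using separation_of_variables by blast
  have "1 / U f * deriv U f * f = T * (sin (\<theta> f))\<^sup>2" if f: "f \<in> f_values V Z" for f
  proof -
    have "sin (\<theta> f) \<noteq> 0" using az f by (auto simp: azimuthal_angle_def)
    then show ?thesis unfolding T[OF f, symmetric] A_def by simp
  qed
  moreover have "(deriv \<theta> f)\<^sup>2 = H\<^sup>2 * (1 / U f) * deriv (deriv U) f" if "f \<in> f_values V Z" for f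
    using that eq(1) by (auto simp: f_values_def)
  ultimately show ?thesis by blast
qed

lemma angle_representation_iff_polar_equation:
  assumes H: "H > 0" and az: "azimuthal_angle V Z \<theta>" and po: "polar_angle V \<phi>"
    and eqs: "\<And>f. f \<in> f_values V Z \<Longrightarrow> (deriv \<theta> f)\<^sup>2 = H\<^sup>2 * (1 / U f) * deriv (deriv U) f"
      "\<And>f. f \<in> f_values V Z \<Longrightarrow> 1 / U f * deriv U f * f = C / H\<^sup>2 * (sin (\<theta> f))\<^sup>2"
  shows "angle_representation V F H (\<lambda>y. \<theta> (f_of Z y)) (\<lambda>y. \<phi> (t_of y)) \<longleftrightarrow>
    (\<forall>t\<in>t_values V. (deriv \<phi> t)\<^sup>2 = C * (deriv (deriv Z) t / Z t))"
proof -
  have step: "(deriv \<phi> (t_of y))\<^sup>2 * (sin (\<theta> (f_of Z y)))\<^sup>2 =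
      H\<^sup>2 * (1 / U (f_of Z y) * deriv U (f_of Z y) * f_of Z y) * r \<longleftrightarrow>
    (deriv \<phi> (t_of y))\<^sup>2 = C * r" if y: "y \<in> V" for y r
  proof -
    have "H\<^sup>2 * (1 / U (f_of Z y) * deriv U (f_of Z y) * f_of Z y) * r =
        C * r * (sin (\<theta> (f_of Z y)))\<^sup>2"
      unfolding eqs(2)[OF f_in[OF y]] using H by simp
    then show ?thesis using azimuthal_angleD(3)[OF az y] by simp
  qed
  note angle_representation_iff[OF H azimuthal_angleD(4)[OF az] polar_angleD(3)[OF po]]
  also have "(\<forall>y\<in>V.
      (deriv \<theta> (f_of Z y))\<^sup>2 = H\<^sup>2 * (1 / U (f_of Z y)) * deriv (deriv U) (f_of Z y) \<and>
      (deriv \<phi> (t_of y))\<^sup>2 * (sin (\<theta> (f_of Z y)))\<^sup>2 =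
        H\<^sup>2 * (1 / U (f_of Z y) * deriv U (f_of Z y) * f_of Z y) *
          (deriv (deriv Z) (t_of y) / Z (t_of y))) \<longleftrightarrow>
    (\<forall>y\<in>V. (deriv \<phi> (t_of y))\<^sup>2 = C * (deriv (deriv Z) (t_of y) / Z (t_of y)))"
    using eqs(1)[OF f_in] step by blast
  finally show ?thesis unfolding t_values_def by blast
qed

text \<open>The sign of \<open>C\<close> is not assumed: it is forced, together with that of \<open>Z'' / Z\<close>, by the positivity of the
  separated product.\<close>

lemma polar_rate_pos:
  assumes H: "H > 0" and az: "azimuthal_angle V Z \<theta>"
    and eq: "\<And>f. f \<in> f_values V Z \<Longrightarrow> 1 / U f * deriv U f * f = C / H\<^sup>2 * (sin (\<theta> f))\<^sup>2"
    and t: "t \<in> t_values V"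
  shows "C * (deriv (deriv Z) t / Z t) > 0"
proof -
  obtain y where y: "y \<in> V" "t = t_of y" using t by (auto simp: t_values_def)
  have "0 < C / H\<^sup>2 * (sin (\<theta> (f_of Z y)))\<^sup>2 * (deriv (deriv Z) t / Z t)"
    using separated_product_pos[OF y(1)] unfolding eq[OF f_in[OF y(1)]] y(2) .
  also have "\<dots> = (sin (\<theta> (f_of Z y)))\<^sup>2 / H\<^sup>2 * (C * (deriv (deriv Z) t / Z t))" by simp
  finally have "0 < (sin (\<theta> (f_of Z y)))\<^sup>2 / H\<^sup>2 * (C * (deriv (deriv Z) t / Z t))" .
  then show ?thesis
    by (rule zero_less_mult_pos) (use H azimuthal_angleD(3)[OF az y(1)] in simp)
qed

lemma exists_polar_angle:
  assumes pos: "\<And>t. t \<in> t_values V \<Longrightarrow> C * (deriv (deriv Z) t / Z t) > 0"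
  shows "\<exists>\<phi>. polar_angle V \<phi> \<and> (\<forall>t\<in>t_values V. (deriv \<phi> t)\<^sup>2 = C * (deriv (deriv Z) t / Z t))"
proof -
  let ?J = "t_values V"
  let ?r = "\<lambda>t. C * (deriv (deriv Z) t / Z t)"
  have Ckr: "Ck_on 2 ?J ?r"
  proof (rule Ck_on_mult[OF open_t_values Ck_on_const[OF open_t_values]])
    show "Ck_on 2 ?J (\<lambda>t. deriv (deriv Z) t / Z t)"
    proof (rule Ck_on_divide[OF open_t_values Z_derivs(3) Ck_on_antimono[OF _ open_t_values Ck_Z]])
      show "Z t \<noteq> 0" if "t \<in> ?J" for t using that Z_nonzero by (auto simp: t_values_def)
    qed simp
  qed
  have Ckg: "Ck_on 2 ?J (\<lambda>t. sqrt (?r t))"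
    by (rule Ck_on_compose[OF open_t_values _ Ck_on_sqrt Ckr]) (use pos in auto)
  obtain \<phi> where \<phi>: "\<And>t. t \<in> ?J \<Longrightarrow> (\<phi> has_real_derivative sqrt (?r t)) (at t)"
    using antiderivative_on_open_interval[OF open_t_values connected_t_values
        Ck_on_imp_continuous_on[OF Ckg]] by blast
  have "Ck_on 3 ?J \<phi>"
    using Ck_on_real_SucI[OF open_t_values \<phi> Ckg] by (simp add: eval_nat_numeral del: Ck_on.simps)
  moreover have less: "\<phi> a < \<phi> b" if "a \<in> ?J" "b \<in> ?J" "a < b" for a b
  proof (rule DERIV_pos_imp_increasing[OF that(3)])
    fix t assume "a \<le> t" "t \<le> b"
    then have "t \<in> ?J" using connected_t_values that unfolding connected_iff_interval by blast
    then show "\<exists>d. (\<phi> has_real_derivative d) (at t) \<and> d > 0" using \<phi> pos real_sqrt_gt_zero by blast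
  qed
  then have "inj_on \<phi> ?J" unfolding inj_on_def by (metis less_irrefl linorder_neqE)
  moreover have "(deriv \<phi> t)\<^sup>2 = ?r t" if "t \<in> ?J" for t
    using DERIV_imp_deriv[OF \<phi>[OF that]] pos[OF that] by (simp only: real_sqrt_pow2 less_imp_le)
  ultimately show ?thesis unfolding polar_angle_def by blast
qed

lemma polar_angle_integral:
  assumes po: "polar_angle V \<phi>"
    and eq: "\<And>t. t \<in> t_values V \<Longrightarrow> (deriv \<phi> t)\<^sup>2 = C * (deriv (deriv Z) t / Z t)"
    and pos: "\<And>t. t \<in> t_values V \<Longrightarrow> C * (deriv (deriv Z) t / Z t) > 0"
  shows "\<exists>s\<in>{1, -1}. \<forall>a\<in>t_values V. \<forall>b\<in>t_values V. a \<le> b \<longrightarrow>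
    ((\<lambda>t. sqrt (C * (deriv (deriv Z) t / Z t))) has_integral s * (\<phi> b - \<phi> a)) {a..b}"
proof -
  have nz: "deriv \<phi> t \<noteq> 0" if "t \<in> t_values V" for t
    using eq[OF that] pos[OF that] by auto
  obtain s where s: "s \<in> {1, -1}" "\<And>a b. a \<in> t_values V \<Longrightarrow> b \<in> t_values V \<Longrightarrow> a \<le> b \<Longrightarrow>
      ((\<lambda>t. \<bar>deriv \<phi> t\<bar>) has_integral s * (\<phi> b - \<phi> a)) {a..b}"
    using abs_deriv_has_integral[OF connected_t_values
        Ck_on_imp_continuous_on[OF polar_angleD(4)[OF po]] polar_angleD(3)[OF po] nz] by blast
  have "((\<lambda>t. sqrt (C * (deriv (deriv Z) t / Z t))) has_integral s * (\<phi> b - \<phi> a)) {a..b}"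
    if ab: "a \<in> t_values V" "b \<in> t_values V" "a \<le> b" for a b
  proof (rule has_integral_eq[OF _ s(2)[OF ab]])
    fix t assume "t \<in> {a..b}"
    then have "t \<in> t_values V"
      using connected_t_values ab unfolding connected_iff_interval by (meson atLeastAtMost_iff)
    then show "\<bar>deriv \<phi> t\<bar> = sqrt (C * (deriv (deriv Z) t / Z t))"
      by (simp only: eq[symmetric] real_sqrt_abs)
  qed
  then show ?thesis using s(1) by blast
qed

lemma finsleroid_of_equations:
  assumes H: "H > 0" and az: "azimuthal_angle V Z \<theta>"
    and eqs: "\<And>f. f \<in> f_values V Z \<Longrightarrow> (deriv \<theta> f)\<^sup>2 = H\<^sup>2 * (1 / U f) * deriv (deriv U) f"
      "\<And>f. f \<in> f_values V Z \<Longrightarrow> 1 / U f * deriv U f * f = C / H\<^sup>2 * (sin (\<theta> f))\<^sup>2"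
  shows "has_constant_curvature (indicatrix V F) (metric_tensor F) (H\<^sup>2)"
    "\<exists>\<phi>. polar_angle V \<phi> \<and>
      angle_representation V F H (\<lambda>y. \<theta> (f_of Z y)) (\<lambda>y. \<phi> (t_of y))"
proof -
  obtain \<phi> where "polar_angle V \<phi>"
      "\<forall>t\<in>t_values V. (deriv \<phi> t)\<^sup>2 = C * (deriv (deriv Z) t / Z t)"
    using exists_polar_angle[OF polar_rate_pos[OF H az eqs(2)]] by blast
  then have \<phi>: "polar_angle V \<phi>" "angle_representation V F H (\<lambda>y. \<theta> (f_of Z y)) (\<lambda>y. \<phi> (t_of y))"
    using angle_representation_iff_polar_equation[OF H az _ eqs] by auto
  then show "\<exists>\<phi>. polar_angle V \<phi> \<and>
      angle_representation V F H (\<lambda>y. \<theta> (f_of Z y)) (\<lambda>y. \<phi> (t_of y))" by blast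
  show "has_constant_curvature (indicatrix V F) (metric_tensor F) (H\<^sup>2)"
    by (rule has_constant_curvature_of_angle_representation[OF H az \<phi>])
qed

end

section \<open>Finsleroid spaces\<close>

lemma azimuthal_angle_subset:
  "azimuthal_angle V Z \<theta> \<Longrightarrow> f_values V' Z' \<subseteq> f_values V Z \<Longrightarrow> azimuthal_angle V' Z' \<theta>"
  unfolding azimuthal_angle_def by (blast intro: Ck_on_subset inj_on_subset)

text \<open>The equations involve \<open>U\<close> and \<open>\<theta>\<close> only, which is why nothing is imposed on \<open>Z\<close>.\<close>

lemma finsleroid_space_of_equations:
  assumes space: "uz_finsler_space M V F U Z"
    and H: "\<And>x. x \<in> M \<Longrightarrow> 0 < H x"
    and az: "\<And>x. x \<in> M \<Longrightarrow> azimuthal_angle (V x) (Z x) (\<theta> x)"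
    and eqs: "finsleroid_equations M (\<lambda>x. f_values (V x) (Z x)) H U \<theta> T C"
  shows "finsleroid_space M V F Z H \<theta>"
    and "\<And>\<phi> x. \<lbrakk>x \<in> M; polar_angle (V x) \<phi>;
        angle_representation (V x) (F x) (H x) (\<lambda>y. \<theta> x (f_of (Z x) y)) (\<lambda>y. \<phi> (t_of y))\<rbrakk> \<Longrightarrow>
      (\<forall>t\<in>t_values (V x). (deriv \<phi> t)\<^sup>2 = C x * (deriv (deriv (Z x)) t / Z x t)) \<and>
      (\<exists>s\<in>{1, -1}. \<forall>a\<in>t_values (V x). \<forall>b\<in>t_values (V x). a \<le> b \<longrightarrow>
        ((\<lambda>t. sqrt (C x * (deriv (deriv (Z x)) t / Z x t))) has_integral s * (\<phi> b - \<phi> a)) {a..b})"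
proof -
  have uz: "uz_function (V x) (F x) (U x) (Z x)" if "x \<in> M" for x
    using space that by (simp add: uz_finsler_space_def uz_function_def)
  have eq1: "(deriv (\<theta> x) f)\<^sup>2 = (H x)\<^sup>2 * (1 / U x f) * deriv (deriv (U x)) f"
    and eq2: "1 / U x f * deriv (U x) f * f = C x / (H x)\<^sup>2 * (sin (\<theta> x f))\<^sup>2"
    if "x \<in> M" "f \<in> f_values (V x) (Z x)" for x f
    using eqs that unfolding finsleroid_equations_def by metis+
  have curv: "has_constant_curvature (indicatrix (V x) (F x)) (metric_tensor (F x)) ((H x)\<^sup>2)"
    and ex: "\<exists>\<phi>. polar_angle (V x) \<phi> \<and>
      angle_representation (V x) (F x) (H x) (\<lambda>y. \<theta> x (f_of (Z x) y)) (\<lambda>y. \<phi> (t_of y))"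
    if "x \<in> M" for x
    using uz_function.finsleroid_of_equations[OF uz H az eq1 eq2] that by blast+
  have "\<exists>\<phi>. \<forall>x\<in>M. polar_angle (V x) (\<phi> x) \<and>
      angle_representation (V x) (F x) (H x) (\<lambda>y. \<theta> x (f_of (Z x) y)) (\<lambda>y. \<phi> x (t_of y))"
    by (rule bchoice) (use ex in blast)
  then show "finsleroid_space M V F Z H \<theta>"
    using curv by (simp add: finsleroid_space_def)
  fix \<phi> x
  assume x: "x \<in> M" and po: "polar_angle (V x) \<phi>"
    and rep: "angle_representation (V x) (F x) (H x) (\<lambda>y. \<theta> x (f_of (Z x) y)) (\<lambda>y. \<phi> (t_of y))"
  have rate: "\<forall>t\<in>t_values (V x). (deriv \<phi> t)\<^sup>2 = C x * (deriv (deriv (Z x)) t / Z x t)"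
    using uz_function.angle_representation_iff_polar_equation[OF uz[OF x] H[OF x] az[OF x] po
        eq1[OF x] eq2[OF x]] rep by blast
  moreover have "\<exists>s\<in>{1, -1}. \<forall>a\<in>t_values (V x). \<forall>b\<in>t_values (V x). a \<le> b \<longrightarrow>
        ((\<lambda>t. sqrt (C x * (deriv (deriv (Z x)) t / Z x t))) has_integral s * (\<phi> b - \<phi> a)) {a..b}"
    using rate uz_function.polar_angle_integral[OF uz[OF x] po _
        uz_function.polar_rate_pos[OF uz[OF x] H[OF x] az[OF x] eq2[OF x]]] by blast
  ultimately show "(\<forall>t\<in>t_values (V x). (deriv \<phi> t)\<^sup>2 = C x * (deriv (deriv (Z x)) t / Z x t)) \<and>
      (\<exists>s\<in>{1, -1}. \<forall>a\<in>t_values (V x). \<forall>b\<in>t_values (V x). a \<le> b \<longrightarrow>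
        ((\<lambda>t. sqrt (C x * (deriv (deriv (Z x)) t / Z x t))) has_integral s * (\<phi> b - \<phi> a)) {a..b})"
    by blast
qed

lemma equations_of_finsleroid_space:
  assumes space: "uz_finsler_space M V F U Z"
    and H: "\<And>x. x \<in> M \<Longrightarrow> 0 < H x"
    and az: "\<And>x. x \<in> M \<Longrightarrow> azimuthal_angle (V x) (Z x) (\<theta> x)"
    and fin: "finsleroid_space M V F Z H \<theta>"
  shows "\<exists>T C. finsleroid_equations M (\<lambda>x. f_values (V x) (Z x)) H U \<theta> T C"
proof -
  have uz: "uz_function (V x) (F x) (U x) (Z x)" if "x \<in> M" for x
    using space that by (simp add: uz_finsler_space_def uz_function_def)
  have "\<exists>T. \<forall>f\<in>f_values (V x) (Z x).
      (deriv (\<theta> x) f)\<^sup>2 = (H x)\<^sup>2 * (1 / U x f) * deriv (deriv (U x)) f \<and>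
      1 / U x f * deriv (U x) f * f = T * (sin (\<theta> x f))\<^sup>2" if x: "x \<in> M" for x
    using uz_function.equations_of_angle_representation[OF uz[OF x] H[OF x] az[OF x]] fin x
    unfolding finsleroid_space_def by blast
  then have "\<exists>T. \<forall>x\<in>M. \<forall>f\<in>f_values (V x) (Z x).
      (deriv (\<theta> x) f)\<^sup>2 = (H x)\<^sup>2 * (1 / U x f) * deriv (deriv (U x)) f \<and>
      1 / U x f * deriv (U x) f * f = T x * (sin (\<theta> x f))\<^sup>2"
    by (intro bchoice) blast
  then obtain T where T: "\<forall>x\<in>M. \<forall>f\<in>f_values (V x) (Z x).
      (deriv (\<theta> x) f)\<^sup>2 = (H x)\<^sup>2 * (1 / U x f) * deriv (deriv (U x)) f \<and>
      1 / U x f * deriv (U x) f * f = T x * (sin (\<theta> x f))\<^sup>2" ..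
  have "finsleroid_equations M (\<lambda>x. f_values (V x) (Z x)) H U \<theta> T (\<lambda>x. T x * (H x)\<^sup>2)"
    unfolding finsleroid_equations_def using T H by force
  then show ?thesis by blast
qed

theorem mainTheorem1:
  fixes M :: "'m set"
    and V :: "'m \<Rightarrow> (real^3) set"
    and F :: "'m \<Rightarrow> real^3 \<Rightarrow> real"
    and U Z \<theta> :: "'m \<Rightarrow> real \<Rightarrow> real"
    and H :: "'m \<Rightarrow> real"
  assumes "uz_finsler_space M V F U Z"
    and "\<forall>x\<in>M. 0 < H x \<and> H x \<le> 1"
    and "\<forall>x\<in>M. azimuthal_angle (V x) (Z x) (\<theta> x)"
  shows
    "(finsleroid_space M V F Z H \<theta> \<longleftrightarrow>
        (\<exists>T C. finsleroid_equations M (\<lambda>x. f_values (V x) (Z x)) H U \<theta> T C)) \<and>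
     (\<forall>T C. finsleroid_equations M (\<lambda>x. f_values (V x) (Z x)) H U \<theta> T C \<longrightarrow>
        (\<forall>V' F' Z'.
           uz_finsler_space M V' F' U Z' \<and>
           (\<forall>x\<in>M. f_values (V' x) (Z' x) \<subseteq> f_values (V x) (Z x)) \<longrightarrow>
             finsleroid_space M V' F' Z' H \<theta> \<and>
             (\<forall>\<phi>. (\<forall>x\<in>M. polar_angle (V' x) (\<phi> x) \<and>
                     angle_representation (V' x) (F' x) (H x)
                       (\<lambda>y. \<theta> x (f_of (Z' x) y)) (\<lambda>y. \<phi> x (t_of y))) \<longrightarrow>
                (\<forall>x\<in>M.
                   (\<forall>t\<in>t_values (V' x).
                      (deriv (\<phi> x) t)\<^sup>2 = C x * (deriv (deriv (Z' x)) t / Z' x t)) \<and>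
                   (\<exists>s\<in>{1, -1}. \<forall>a\<in>t_values (V' x). \<forall>b\<in>t_values (V' x). a \<le> b \<longrightarrow>
                      ((\<lambda>t. sqrt (C x * (deriv (deriv (Z' x)) t / Z' x t)))
                         has_integral s * (\<phi> x b - \<phi> x a)) {a..b})))))"
proof (intro conjI iffI allI impI)
  have H: "\<And>x. x \<in> M \<Longrightarrow> 0 < H x" and az: "\<And>x. x \<in> M \<Longrightarrow> azimuthal_angle (V x) (Z x) (\<theta> x)"
    using assms(2,3) by auto
  show "\<exists>T C. finsleroid_equations M (\<lambda>x. f_values (V x) (Z x)) H U \<theta> T C"
    if "finsleroid_space M V F Z H \<theta>"
    by (rule equations_of_finsleroid_space[OF assms(1) H az that])
  show "finsleroid_space M V F Z H \<theta>"
    if "\<exists>T C. finsleroid_equations M (\<lambda>x. f_values (V x) (Z x)) H U \<theta> T C"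
    using that finsleroid_space_of_equations(1)[where H = H, OF assms(1) H az] by blast
  fix T C V' F' Z'
  assume eqs: "finsleroid_equations M (\<lambda>x. f_values (V x) (Z x)) H U \<theta> T C"
    and A: "uz_finsler_space M V' F' U Z' \<and>
      (\<forall>x\<in>M. f_values (V' x) (Z' x) \<subseteq> f_values (V x) (Z x))"
  have az': "azimuthal_angle (V' x) (Z' x) (\<theta> x)" if "x \<in> M" for x
    using azimuthal_angle_subset[OF az[OF that]] A that by blast
  have eqs': "finsleroid_equations M (\<lambda>x. f_values (V' x) (Z' x)) H U \<theta> T C"
    using eqs A unfolding finsleroid_equations_def by blast
  note B = finsleroid_space_of_equations[where H = H, OF conjunct1[OF A] H az' eqs']
  show "finsleroid_space M V' F' Z' H \<theta>" by (rule B(1))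
  fix \<phi>
  assume "\<forall>x\<in>M. polar_angle (V' x) (\<phi> x) \<and>
    angle_representation (V' x) (F' x) (H x) (\<lambda>y. \<theta> x (f_of (Z' x) y)) (\<lambda>y. \<phi> x (t_of y))"
  then show "\<forall>x\<in>M.
     (\<forall>t\<in>t_values (V' x). (deriv (\<phi> x) t)\<^sup>2 = C x * (deriv (deriv (Z' x)) t / Z' x t)) \<and>
     (\<exists>s\<in>{1, -1}. \<forall>a\<in>t_values (V' x). \<forall>b\<in>t_values (V' x). a \<le> b \<longrightarrow>
        ((\<lambda>t. sqrt (C x * (deriv (deriv (Z' x)) t / Z' x t))) has_integral
          s * (\<phi> x b - \<phi> x a)) {a..b})"
    using B(2) by blast
qed

end
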